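(* Let $1<p<\infty$, let $B$ be a finite Blaschke product of degree $n\ge1$, and let $u_1,\dots,u_n$ be an (algebraic) basis of the model space $K_B$. A bounded linear operator $W$ on the Hardy space $H^p$ commutes with $T_B$ if and only if there exist $\phi_1,\dots,\phi_n$ in the multiplier algebra of $H^p$ such that $$W\Big(\sum_{j=1}^n u_j\,(f_j\circ B)\Big)=\sum_{k=1}^n\phi_k\,(f_k\circ B)\qquad\text{for all } f_1,\dots,f_n\in H^p .$$
   Context: $\mathbb{D}$ is the open unit disc and $H^p$ is the space of analytic $f$ on $\mathbb{D}$ with $\|f\|_p=\big(\sup_{0\le r<1}\int_0^{2\pi}|f(re^{i\theta})|^p\frac{d\theta}{2\pi}\big)^{1/p}<\infty$. The multiplier algebra of $H^p$ is the set of analytic functions $\varphi$ on $\mathbb{D}$ with $\varphi f\in H^p$ for every $f\in H^p$. A finite Blaschke product of degree $n$ is $B(z)=e^{i\theta}\prod_{i=1}^n\frac{z-\alpha_i}{1-\overline{\alpha_i}z}$ with $\theta\in\mathbb{R}$ and $\alpha_i\in\mathbb{D}$ (repetitions allowed). $T_B$ is the operator $f\mapsto Bf$ on $H^p$. The model space $K_B$ is the $n$-dimensional space $H^2\ominus BH^2$; it consists of bounded functions and coincides with $H^p\cap B\overline{H^p_0}$ for every $1<p<\infty$, where $H^p_0=\{f\in H^p: f(0)=0\}$ and functions are identified with their boundary values on the unit circle. *)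

theory Defs
  imports "HOL-Complex_Analysis.Complex_Analysis" "HOL-Library.Function_Algebras"
begin

text \<open>
  A function on the open unit disc is represented by its extension by zero to all of \<open>complex\<close>,
  so that equality of functions on the disc is HOL equality.
\<close>

definition disc_analytic :: "(complex \<Rightarrow> complex) set" where
  "disc_analytic = {f. f holomorphic_on ball 0 1 \<and> (\<forall>z. z \<notin> ball 0 1 \<longrightarrow> f z = 0)}"

definition hardy_mean :: "real \<Rightarrow> (complex \<Rightarrow> complex) \<Rightarrow> real \<Rightarrow> real" where
  "hardy_mean p f r =
     integral {0..2 * pi} (\<lambda>\<theta>. norm (f (of_real r * cis \<theta>)) powr p / (2 * pi))"

definition hardy_space :: "real \<Rightarrow> (complex \<Rightarrow> complex) set" where
  "hardy_space p = {f \<in> disc_analytic. bdd_above (hardy_mean p f ` {0..<1})}"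

definition hardy_norm :: "real \<Rightarrow> (complex \<Rightarrow> complex) \<Rightarrow> real" where
  "hardy_norm p f = (SUP r\<in>{0..<1}. hardy_mean p f r) powr (1 / p)"

definition hardy_multipliers :: "real \<Rightarrow> (complex \<Rightarrow> complex) set" where
  "hardy_multipliers p =
     {\<phi> \<in> disc_analytic. \<forall>f \<in> hardy_space p. (\<lambda>z. \<phi> z * f z) \<in> hardy_space p}"

text \<open>
  The inner product of \<open>H\<^sup>2\<close>. On \<open>H\<^sup>2\<close> the limit always exists, agrees with the integral of
  the boundary values over the unit circle, and induces \<open>hardy_norm 2\<close>, since the integral
  means increase with the radius.
\<close>

definition hardy_inner :: "(complex \<Rightarrow> complex) \<Rightarrow> (complex \<Rightarrow> complex) \<Rightarrow> complex" where
  "hardy_inner f g = Lim (at_left (1::real))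
     (\<lambda>r. integral {0..2 * pi}
        (\<lambda>\<theta>. f (of_real r * cis \<theta>) * cnj (g (of_real r * cis \<theta>)) / of_real (2 * pi)))"

text \<open>Only the values of \<open>B\<close> on the disc are constrained.\<close>

definition finite_blaschke :: "nat \<Rightarrow> (complex \<Rightarrow> complex) \<Rightarrow> bool" where
  "finite_blaschke n B \<longleftrightarrow>
     (\<exists>(\<theta>::real) (\<alpha>::nat \<Rightarrow> complex). (\<forall>i<n. \<alpha> i \<in> ball 0 1) \<and>
        (\<forall>z \<in> ball 0 1. B z = cis \<theta> * (\<Prod>i<n. (z - \<alpha> i) / (1 - cnj (\<alpha> i) * z))))"

definition mult_op :: "(complex \<Rightarrow> complex) \<Rightarrow> (complex \<Rightarrow> complex) \<Rightarrow> (complex \<Rightarrow> complex)" where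
  "mult_op B f = (\<lambda>z. B z * f z)"

definition model_space :: "(complex \<Rightarrow> complex) \<Rightarrow> (complex \<Rightarrow> complex) set" where
  "model_space B =
     {f \<in> hardy_space 2. \<forall>g \<in> hardy_space 2. hardy_inner f (mult_op B g) = 0}"

definition fun_scale :: "complex \<Rightarrow> (complex \<Rightarrow> complex) \<Rightarrow> (complex \<Rightarrow> complex)" where
  "fun_scale c f = (\<lambda>z. c * f z)"

global_interpretation cfun: vector_space fun_scale
  by unfold_locales (auto simp: fun_scale_def fun_eq_iff algebra_simps)

definition indexed_basis ::
  "nat \<Rightarrow> (nat \<Rightarrow> complex \<Rightarrow> complex) \<Rightarrow> (complex \<Rightarrow> complex) set \<Rightarrow> bool" where
  "indexed_basis n u V \<longleftrightarrow>
     inj_on u {..<n} \<and> cfun.independent (u ` {..<n}) \<and> cfun.span (u ` {..<n}) = V"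

text \<open>The behaviour of \<open>W\<close> outside \<open>H\<^sup>p\<close> is irrelevant.\<close>

definition bounded_hardy_operator ::
  "real \<Rightarrow> ((complex \<Rightarrow> complex) \<Rightarrow> (complex \<Rightarrow> complex)) \<Rightarrow> bool" where
  "bounded_hardy_operator p W \<longleftrightarrow>
     (\<forall>f \<in> hardy_space p. W f \<in> hardy_space p) \<and>
     (\<forall>f \<in> hardy_space p. \<forall>g \<in> hardy_space p. W (f + g) = W f + W g) \<and>
     (\<forall>c. \<forall>f \<in> hardy_space p. W (fun_scale c f) = fun_scale c (W f)) \<and>
     (\<exists>C. \<forall>f \<in> hardy_space p. hardy_norm p (W f) \<le> C * hardy_norm p f)"

end

theory Submission
  imports Defs
begin

text \<open>
  If \<open>W\<close> commutes with \<open>T\<^sub>B\<close>, the only possible choice is \<open>\<phi>\<^sub>j = W u\<^sub>j\<close>. The identity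
  \<open>W (v \<cdot> (g \<circ> B)) = W v \<cdot> (g \<circ> B)\<close> for bounded \<open>v\<close> and \<open>g \<in> H\<^sup>p\<close> is algebra
  (\<open>commuting_formula\<close>): at a point \<open>l\<close> with \<open>w = B l\<close> write \<open>g = g w + (z - w) h\<close> with
  \<open>h \<in> H\<^sup>p\<close>; composing with \<open>B\<close> and commuting \<open>W\<close> past \<open>B\<close> gives \<open>B - w\<close> as a factor of the
  second summand, and it vanishes at \<open>l\<close>. That \<open>W v\<close> is a multiplier holds because it is bounded
  (\<open>commuting_image_multiplier\<close>). This is seen by applying the identity to the powers
  \<open>g z = (1 - cnj w \<cdot> z) powr (-2 / p)\<close> of the Szego kernel with \<open>w = B l\<close>: the growth estimate at \<open>l\<close>
  leaves \<open>\<bar>W v l\<bar>\<^sup>p \<le> const \<cdot> (1 - \<bar>B l\<bar>\<^sup>2) / (1 - \<bar>l\<bar>)\<close>, which is bounded for a finite Blaschke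
  product.

  Conversely, the formula for \<open>W\<close> gives \<open>W (B f) = B (W f)\<close> for \<open>f = v \<cdot> (h \<circ> B)\<close> with \<open>v \<in> K\<^sub>B\<close>.
  If \<open>B = c P / Q\<close> with polynomials of degree at most \<open>n\<close>, then \<open>K\<^sub>B\<close> consists of the quotients
  \<open>R / Q\<close> with \<open>deg R < n\<close> (\<open>model_monomial_span\<close>), and repeated elimination of top powers shows
  that finite sums of functions \<open>v \<cdot> (h \<circ> B)\<close> include all polynomials
  (\<open>hardy_space_subset_module\<close>). Polynomials are dense in \<open>H\<^sup>p\<close>, and by boundedness of \<open>W\<close> the set
  of \<open>f\<close> with \<open>W (B f) = B (W f)\<close> is closed.

  The analytic input is Littlewood's subordination principle (\<open>subordination\<close>), a consequence of the
  Poisson formula. Applied to self-maps of the disc it yields that \<open>f \<mapsto> f \<circ> B\<close> is bounded on \<open>H\<^sup>p\<close>, the growth estimate for \<open>f\<close>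
  (constant self-map) and the monotonicity of the integral means (self-map \<open>z \<mapsto> c z\<close>).
  Density of polynomials reduces to the convergence of the dilations \<open>f (r z)\<close> to \<open>f\<close>, obtained
  from a pointwise form of the uniform convexity of \<open>L\<^sup>p\<close> (\<open>dilate_tendsto\<close>).
\<close>

section \<open>Poisson integrals on the unit circle\<close>

definition poisson :: "complex \<Rightarrow> real \<Rightarrow> real" where
  "poisson z \<theta> = (1 - (norm z)\<^sup>2) / (norm (cis \<theta> - z))\<^sup>2"

lemma cis_neq_disc: "norm z < 1 \<Longrightarrow> cis \<theta> \<noteq> z"
  using norm_cis[of \<theta>] by auto

lemma poisson_nonneg: "norm z < 1 \<Longrightarrow> 0 \<le> poisson z \<theta>"
  by (simp add: poisson_def power_le_one)

lemma poisson_le: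
  assumes "norm z < 1"
  shows "poisson z \<theta> \<le> (1 + norm z) / (1 - norm z)"
proof -
  have "1 - norm z \<le> norm (cis \<theta> - z)"
    using norm_triangle_ineq2[of "cis \<theta>" z] by simp
  then have "(1 - norm z)\<^sup>2 \<le> (norm (cis \<theta> - z))\<^sup>2"
    using assms by (intro power_mono) auto
  then have "poisson z \<theta> \<le> (1 - (norm z)\<^sup>2) / (1 - norm z)\<^sup>2"
    unfolding poisson_def using assms cis_neq_disc[OF assms]
    by (intro divide_left_mono) (auto simp: power_le_one)
  also have "\<dots> = (1 + norm z) / (1 - norm z)"
  proof -
    have "1 - (norm z)\<^sup>2 = (1 + norm z) * (1 - norm z)" by (simp add: algebra_simps power2_eq_square)
    then show ?thesis using assms by (simp add: power2_eq_square)
  qed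
  finally show ?thesis .
qed

lemma poisson_0 [simp]: "poisson 0 \<theta> = 1"
  by (simp add: poisson_def)

lemma poisson_eq_Re:
  assumes "norm z < 1"
  shows "poisson z \<theta> = Re ((cis \<theta> + z) / (cis \<theta> - z))"
proof -
  have ne: "cis \<theta> - z \<noteq> 0" using cis_neq_disc[OF assms] by simp
  have "(cis \<theta> + z) / (cis \<theta> - z) = (cis \<theta> + z) * cnj (cis \<theta> - z) / of_real ((norm (cis \<theta> - z))\<^sup>2)"
    using ne unfolding complex_norm_square by (simp add: divide_simps)
  moreover have "Re ((cis \<theta> + z) * cnj (cis \<theta> - z)) = 1 - (norm z)\<^sup>2"
    using sin_cos_squared_add3[of \<theta>] cmod_power2[of z] by (simp add: algebra_simps power2_eq_square)
  ultimately show ?thesis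
    by (simp add: poisson_def Re_divide_of_real del: of_real_power)
qed

lemma poisson_complex_form:
  assumes "norm z < 1"
  shows "complex_of_real (poisson z \<theta>) = (1 - (norm z)\<^sup>2) * cis \<theta> / ((1 - cnj z * cis \<theta>) * (cis \<theta> - z))"
proof -
  have ne: "cis \<theta> - z \<noteq> 0" using cis_neq_disc[OF assms] by simp
  have c: "cis \<theta> * cnj (cis \<theta>) = 1"
    by (simp add: cis_mult cis_cnj)
  have "1 - cnj z * cis \<theta> = cis \<theta> * cnj (cis \<theta> - z)"
    using c by (simp add: algebra_simps)
  then have "(1 - cnj z * cis \<theta>) * (cis \<theta> - z) = cis \<theta> * of_real ((norm (cis \<theta> - z))\<^sup>2)"
    unfolding complex_norm_square by (simp only: mult_ac)
  then show ?thesis using ne by (simp add: poisson_def)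
qed

lemma one_minus_cnj_mult_nonzero:
  assumes "norm a < 1" "norm z \<le> 1"
  shows "1 - cnj a * z \<noteq> 0"
proof
  assume "1 - cnj a * z = 0"
  then have "norm (cnj a * z) = 1" by (metis norm_one right_minus_eq)
  moreover have "norm a * norm z \<le> norm a * 1" using assms by (intro mult_left_mono) auto
  ultimately show False using assms by (simp add: norm_mult)
qed

text \<open>
  Cauchy's formula at \<open>z\<close> for the function \<open>F \<zeta> \<cdot> (1 - \<bar>z\<bar>\<^sup>2) / (1 - cnj z \<cdot> \<zeta>)\<close>, which takes the value
  \<open>F z\<close> at \<open>z\<close> and turns the Cauchy kernel into the Poisson kernel on the circle.
\<close>

lemma poisson_formula:
  fixes F :: "complex \<Rightarrow> complex"
  assumes F: "F holomorphic_on ball 0 R" "1 < R" and z: "norm z < 1"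
  shows "((\<lambda>\<theta>. of_real (poisson z \<theta>) * F (cis \<theta>)) has_integral 2 * pi * F z) {0..2*pi}"
proof -
  \<comment> \<open>On the circle, \<open>cis t / (1 - cnj z * cis t)\<close> is the conjugate of \<open>1 / (cis t - z)\<close>.\<close>
  define G where "G = (\<lambda>\<zeta>. F \<zeta> * (1 - (norm z)\<^sup>2) / (1 - cnj z * \<zeta>))"
  have ne: "1 - cnj z * \<zeta> \<noteq> 0" if "norm \<zeta> \<le> 1" for \<zeta>
    using one_minus_cnj_mult_nonzero[OF z that] .
  have "F holomorphic_on cball 0 1"
    using F by (auto intro: holomorphic_on_subset)
  then have hG: "G holomorphic_on cball 0 1"
    unfolding G_def using ne by (intro holomorphic_intros) auto
  have "((\<lambda>\<zeta>. G \<zeta> / (\<zeta> - z)) has_contour_integral 2 * pi * \<i> * G z) (circlepath 0 1)"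
    using Cauchy_integral_circlepath_simple[OF hG, of z] z by simp
  then have "((\<lambda>t. G (cis t) / (cis t - z) * \<i> * cis t) has_integral 2 * pi * \<i> * G z) {0..2*pi}"
    unfolding circlepath_def by (subst (asm) has_contour_integral_part_circlepath_iff) auto
  moreover have "G z = F z"
  proof -
    have "of_real (1 - (norm z)\<^sup>2) = 1 - cnj z * z"
      by (simp add: complex_norm_square mult.commute del: of_real_power)
    then show ?thesis unfolding G_def using ne[of z] z
      by (metis less_imp_le nonzero_mult_div_cancel_right)
  qed
  ultimately have *: "((\<lambda>t. -\<i> * (G (cis t) / (cis t - z) * \<i> * cis t)) has_integral
      -\<i> * (complex_of_real (2 * pi) * \<i> * F z)) {0..2*pi}"
    by (intro has_integral_mult_right) simp
  have 1: "-\<i> * (complex_of_real (2 * pi) * \<i> * F z) = complex_of_real (2 * pi) * F z"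
    by (simp add: complex_i_mult_minus mult_ac)
  have 2: "-\<i> * (G (cis t) / (cis t - z) * \<i> * cis t) = of_real (poisson z t) * F (cis t)" for t
    by (simp add: poisson_complex_form[OF z] G_def complex_i_mult_minus mult_ac)
  show ?thesis using * unfolding 1 2 .
qed

lemma continuous_on_poisson:
  assumes "continuous_on S g" "continuous_on S h" "\<And>x. x \<in> S \<Longrightarrow> norm (g x) < 1"
  shows "continuous_on S (\<lambda>x. poisson (g x) (h x))"
proof -
  have "cis (h x) - g x \<noteq> 0" if "x \<in> S" for x
    using cis_neq_disc[OF assms(3)[OF that], of "h x"] by simp
  then show ?thesis unfolding poisson_def
    using assms by (intro continuous_intros ) auto
qed

lemma poisson_has_integral:
  assumes "norm z < 1"
  shows "(poisson z has_integral 2 * pi) {0..2*pi}"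
proof -
  have "((\<lambda>\<theta>. of_real (poisson z \<theta>) * 1) has_integral 2 * pi * (1::complex)) {0..2*pi}"
    using assms by (intro poisson_formula[of "\<lambda>_. 1" 2]) (auto intro: holomorphic_intros)
  from has_integral_Re[OF this] show ?thesis by (simp flip: of_real_mult)
qed

text \<open>
  The graph of \<open>x \<mapsto> x\<^sup>p\<close> lies strictly above its tangents. The weak form yields Jensen's
  inequality below, and the strict form gives strict convexity.
\<close>

lemma powr_tangent_less:
  fixes s t p :: real
  assumes p: "1 < p" and t: "0 \<le> t" and s: "0 < s" and ne: "t \<noteq> s"
  shows "s powr p + p * s powr (p - 1) * (t - s) < t powr p"
proof -
  have d: "((\<lambda>x. x powr p) has_real_derivative p * x powr (p - 1)) (at x)" if "0 < x" for x
    using that by (auto intro!: derivative_eq_intros)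
  have sp: "s powr p = s powr (p - 1) * s" using s by (simp add: powr_diff)
  consider "t = 0" | "0 < t" "t < s" | "s < t" using t ne by linarith
  then show ?thesis
  proof cases
    case 1
    then show ?thesis using p s by (simp add: sp mult_ac)
  next
    case 2
    from MVT2[OF 2(2), of "\<lambda>x. x powr p" "\<lambda>x. p * x powr (p - 1)"] d 2
    obtain \<xi> where \<xi>: "t < \<xi>" "\<xi> < s" "s powr p - t powr p = (s - t) * (p * \<xi> powr (p - 1))"
      by (metis less_le_trans)
    have "\<xi> powr (p - 1) < s powr (p - 1)" using \<xi> 2 p by (intro powr_less_mono2) auto
    then have "(s - t) * (p * \<xi> powr (p - 1)) < (s - t) * (p * s powr (p - 1))" using 2 p by simp
    then show ?thesis using \<xi>(3) by (simp add: algebra_simps)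
  next
    case 3
    from MVT2[OF 3, of "\<lambda>x. x powr p" "\<lambda>x. p * x powr (p - 1)"] d s
    obtain \<xi> where \<xi>: "s < \<xi>" "\<xi> < t" "t powr p - s powr p = (t - s) * (p * \<xi> powr (p - 1))"
      by (metis less_le_trans)
    have "s powr (p - 1) < \<xi> powr (p - 1)" using \<xi> s p by (intro powr_less_mono2) auto
    then have "(t - s) * (p * s powr (p - 1)) < (t - s) * (p * \<xi> powr (p - 1))" using 3 p by simp
    then show ?thesis using \<xi>(3) by (simp add: algebra_simps)
  qed
qed

lemma powr_tangent_le:
  fixes s t p :: real
  assumes "1 < p" "0 \<le> t" "0 < s"
  shows "s powr p + p * s powr (p - 1) * (t - s) \<le> t powr p"
  using powr_tangent_less[OF assms] by (cases "t = s") auto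

lemma continuous_on_norm_powr:
  fixes f :: "'a::topological_space \<Rightarrow> 'b::real_normed_vector"
  assumes "continuous_on S f" "0 < p"
  shows "continuous_on S (\<lambda>x. norm (f x) powr p)"
  using assms by (intro continuous_on_powr' continuous_intros) auto

text \<open>
  Jensen's inequality for the probability measure with density \<open>poisson z / (2 \<pi>)\<close>: integrate the tangent
  inequality at \<open>s = \<bar>F z\<bar>\<close> and use \<open>2 \<pi> s \<le> \<integral> poisson z \<cdot> \<bar>F\<bar>\<close>.
\<close>

lemma poisson_majorant:
  fixes F :: "complex \<Rightarrow> complex"
  assumes F: "F holomorphic_on ball 0 R" "1 < R" and z: "norm z < 1" and p: "1 < p"
  shows "2 * pi * norm (F z) powr p \<le> integral {0..2*pi} (\<lambda>\<theta>. poisson z \<theta> * norm (F (cis \<theta>)) powr p)"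
proof (cases "F z = 0")
  case True
  have "continuous_on {0..2*pi} (\<lambda>\<theta>. F (cis \<theta>))"
    by (rule continuous_on_compose2[OF holomorphic_on_imp_continuous_on[OF F(1)]])
       (use F(2) in \<open>auto intro: continuous_intros\<close>)
  then have "0 \<le> integral {0..2*pi} (\<lambda>\<theta>. poisson z \<theta> * norm (F (cis \<theta>)) powr p)"
    using p z by (intro integral_nonneg integrable_continuous_interval continuous_intros continuous_on_norm_powr
       continuous_on_poisson mult_nonneg_nonneg poisson_nonneg) auto
  then show ?thesis using True by simp
next
  case False
  define s where "s = norm (F z)"
  have s: "s > 0" using False by (simp add: s_def)
  have cF: "continuous_on {0..2*pi} (\<lambda>\<theta>. F (cis \<theta>))"
    by (rule continuous_on_compose2[OF holomorphic_on_imp_continuous_on[OF F(1)]])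
       (use F(2) in \<open>auto intro: continuous_intros\<close>)
  have cP: "continuous_on {0..2*pi} (\<lambda>\<theta>. poisson z \<theta>)"
    using z by (intro continuous_on_poisson) auto
  have i1: "(\<lambda>\<theta>. poisson z \<theta> * norm (F (cis \<theta>))) integrable_on {0..2*pi}"
    by (intro integrable_continuous_interval continuous_intros cF cP)
  have i2: "(\<lambda>\<theta>. poisson z \<theta> * norm (F (cis \<theta>)) powr p) integrable_on {0..2*pi}"
    using p by (intro integrable_continuous_interval continuous_intros cF cP continuous_on_norm_powr) auto
  have "2 * pi * s \<le> integral {0..2*pi} (\<lambda>\<theta>. poisson z \<theta> * norm (F (cis \<theta>)))"
  proof -
    have "norm (integral {0..2*pi} (\<lambda>\<theta>. of_real (poisson z \<theta>) * F (cis \<theta>)))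
        \<le> integral {0..2*pi} (\<lambda>\<theta>. poisson z \<theta> * norm (F (cis \<theta>)))"
      by (intro integral_norm_bound_integral i1 integrable_continuous_interval continuous_intros cF cP)
         (use z in \<open>auto simp: norm_mult poisson_nonneg\<close>)
    then show ?thesis using integral_unique[OF poisson_formula[OF F z]] by (simp add: norm_mult s_def)
  qed
  then have le: "0 \<le> p * s powr (p - 1) * (integral {0..2*pi} (\<lambda>\<theta>. poisson z \<theta> * norm (F (cis \<theta>))) - 2 * pi * s)"
    using p s by simp
  have I: "((\<lambda>\<theta>. s powr p * poisson z \<theta> + p * s powr (p - 1) * (poisson z \<theta> * norm (F (cis \<theta>)) - s * poisson z \<theta>))
      has_integral (s powr p * (2 * pi) + p * s powr (p - 1) *
         (integral {0..2*pi} (\<lambda>\<theta>. poisson z \<theta> * norm (F (cis \<theta>))) - s * (2 * pi)))) {0..2*pi}"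
    by (intro has_integral_add has_integral_mult_right has_integral_diff poisson_has_integral z
        integrable_integral i1)
  have "2 * pi * s powr p \<le> integral {0..2*pi} (\<lambda>\<theta>. s powr p * poisson z \<theta> +
      p * s powr (p - 1) * (poisson z \<theta> * norm (F (cis \<theta>)) - s * poisson z \<theta>))"
    using le unfolding integral_unique[OF I] by (simp add: mult_ac)
  also have "\<dots> \<le> integral {0..2*pi} (\<lambda>\<theta>. poisson z \<theta> * norm (F (cis \<theta>)) powr p)"
  proof (rule integral_le[OF _ i2])
    show "(\<lambda>\<theta>. s powr p * poisson z \<theta> + p * s powr (p - 1) * (poisson z \<theta> * norm (F (cis \<theta>)) - s * poisson z \<theta>)) integrable_on {0..2*pi}"
      using I by blast
    fix \<theta>
    have "poisson z \<theta> * (s powr p + p * s powr (p - 1) * (norm (F (cis \<theta>)) - s)) \<le> poisson z \<theta> * norm (F (cis \<theta>)) powr p"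
      by (intro mult_left_mono powr_tangent_le poisson_nonneg) (use p s z in auto)
    then show "s powr p * poisson z \<theta> + p * s powr (p - 1) * (poisson z \<theta> * norm (F (cis \<theta>)) - s * poisson z \<theta>) \<le> poisson z \<theta> * norm (F (cis \<theta>)) powr p"
      by (simp add: algebra_simps)
  qed
  finally show ?thesis by (simp add: s_def)
qed

section \<open>Integral means and subordination\<close>

lemma continuous_on_circle:
  assumes f: "f holomorphic_on ball 0 1" and r: "0 \<le> r" "r < 1"
  shows "continuous_on S (\<lambda>\<theta>. f (of_real r * cis \<theta>))"
  by (rule continuous_on_compose2[OF holomorphic_on_imp_continuous_on[OF f]])
     (use r in \<open>auto intro!: continuous_intros simp: norm_mult\<close>)

text \<open>
  The radius \<open>2 / (1 + r)\<close> exceeds 1 also for \<open>r = 0\<close>, so that the closed unit disc lies in the domain.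
\<close>

lemma holomorphic_on_dilate:
  fixes f :: "complex \<Rightarrow> complex"
  assumes f: "f holomorphic_on ball 0 1" and r: "0 \<le> r" "r < 1"
  shows "(\<lambda>z. f (of_real r * z)) holomorphic_on ball 0 (2 / (1 + r))"
proof -
  have "norm (of_real r * z) < 1" if "z \<in> ball 0 (2 / (1 + r))" for z :: complex
  proof -
    have "norm (of_real r * z) = r * norm z" using r by (simp add: norm_mult)
    also have "\<dots> \<le> r * (2 / (1 + r))" using that r by (intro mult_left_mono) auto
    also have "\<dots> < 1" using r by (simp add: field_simps)
    finally show ?thesis .
  qed
  then show ?thesis
    by (intro holomorphic_on_compose_gen[OF _ f, unfolded o_def] holomorphic_intros) auto
qed

lemma holomorphic_on_dilate_disc:
  fixes f :: "complex \<Rightarrow> complex"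
  assumes "f holomorphic_on ball 0 1" "0 \<le> r" "r < 1"
  shows "(\<lambda>z. f (of_real r * z)) holomorphic_on ball 0 1"
proof (rule holomorphic_on_subset[OF holomorphic_on_dilate[OF assms]])
  have "1 \<le> 2 / (1 + r)" using assms by simp
  then show "ball 0 1 \<subseteq> ball (0::complex) (2 / (1 + r))" by (intro subset_ball)
qed

lemma mean_value_circle:
  fixes f :: "complex \<Rightarrow> complex"
  assumes f: "f holomorphic_on ball 0 1" and r: "0 \<le> r" "r < 1"
  shows "((\<lambda>\<theta>. f (of_real r * cis \<theta>)) has_integral 2 * pi * f 0) {0..2*pi}"
  using poisson_formula[OF holomorphic_on_dilate[OF assms], of 0] r by simp

lemma hardy_mean_eq:
  "hardy_mean p f r = integral {0..2*pi} (\<lambda>\<theta>. norm (f (of_real r * cis \<theta>)) powr p) / (2 * pi)"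
  by (simp add: hardy_mean_def)

text \<open>
  Littlewood's subordination principle. Majorise \<open>\<bar>F\<bar>\<^sup>p\<close> at \<open>b (s cis t)\<close> by its Poisson integral and
  exchange the integrals; since \<open>poisson w \<theta>\<close> is the real part of a holomorphic function of \<open>w\<close>, its mean
  along \<open>w = b (s cis t)\<close> is its value at \<open>b 0\<close>.
\<close>

lemma subordination:
  fixes F b :: "complex \<Rightarrow> complex"
  assumes p: "1 < p" and F: "F holomorphic_on ball 0 R" "1 < R"
    and b: "b holomorphic_on ball 0 1" "b ` ball 0 1 \<subseteq> ball 0 1" and s: "0 \<le> s" "s < 1"
  shows "integral {0..2*pi} (\<lambda>t. norm (F (b (of_real s * cis t))) powr p)
      \<le> integral {0..2*pi} (\<lambda>\<theta>. poisson (b 0) \<theta> * norm (F (cis \<theta>)) powr p)"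
proof -
  have b1: "norm (b z) < 1" if "norm z < 1" for z using b(2) that by force
  then have b1': "norm (b (of_real s * cis t)) < 1" for t using s by (simp add: norm_mult)
  have contF: "continuous_on S (\<lambda>x. F (g x))" if "continuous_on S g" "\<And>x. x \<in> S \<Longrightarrow> norm (g x) \<le> 1"
    for g :: "'z::topological_space \<Rightarrow> complex" and S
    by (rule continuous_on_compose2[OF holomorphic_on_imp_continuous_on[OF F(1)] that(1)])
       (use that(2) F(2) in force)
  have contb: "continuous_on S (\<lambda>x. b (of_real s * cis (g x)))" if "continuous_on S g"
    for g :: "'z::topological_space \<Rightarrow> real" and S
    by (rule continuous_on_compose2[OF holomorphic_on_imp_continuous_on[OF b(1)]])
       (use s that in \<open>auto intro!: continuous_intros simp: norm_mult\<close>)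
  let ?k = "\<lambda>t \<theta>. poisson (b (of_real s * cis t)) \<theta> * norm (F (cis \<theta>)) powr p"
  have contk: "continuous_on S (\<lambda>x. ?k (g x) (h x))" if "continuous_on S g" "continuous_on S h"
    for g h :: "'z::topological_space \<Rightarrow> real" and S
    using p b1' that by (intro continuous_intros continuous_on_poisson contb continuous_on_norm_powr contF) auto
  have cont2: "continuous_on (cbox (0, 0) (2*pi, 2*pi)) (\<lambda>(t, \<theta>). ?k t \<theta>)"
    unfolding case_prod_unfold by (intro contk continuous_intros)
  have "2 * pi * integral {0..2*pi} (\<lambda>t. norm (F (b (of_real s * cis t))) powr p)
      = integral {0..2*pi} (\<lambda>t. 2 * pi * norm (F (b (of_real s * cis t))) powr p)"
    by simp
  also have "\<dots> \<le> integral {0..2*pi} (\<lambda>t. integral {0..2*pi} (?k t))"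
  proof (rule integral_le)
    show "(\<lambda>t. 2 * pi * norm (F (b (of_real s * cis t))) powr p) integrable_on {0..2*pi}"
      using p b1' by (intro integrable_continuous_interval continuous_intros continuous_on_norm_powr contF contb)
        (auto intro: less_imp_le)
    have "continuous_on (cbox 0 (2*pi)) (\<lambda>t. integral (cbox 0 (2*pi)) (?k t))"
      by (intro integral_continuous_on_param) (unfold case_prod_unfold, intro contk continuous_intros)
    then show "(\<lambda>t. integral {0..2*pi} (?k t)) integrable_on {0..2*pi}"
      by (intro integrable_continuous_interval) (simp add: cbox_interval)
    show "2 * pi * norm (F (b (of_real s * cis t))) powr p \<le> integral {0..2*pi} (?k t)" for t
      by (rule poisson_majorant[OF F b1' p])
  qed
  also have "\<dots> = integral {0..2*pi} (\<lambda>\<theta>. integral {0..2*pi} (\<lambda>t. ?k t \<theta>))"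
    using integral_swap_continuous[OF cont2] by (simp add: cbox_interval)
  also have "\<dots> = integral {0..2*pi} (\<lambda>\<theta>. 2 * pi * (poisson (b 0) \<theta> * norm (F (cis \<theta>)) powr p))"
  proof (rule integral_cong)
    fix \<theta>
    have hol: "(\<lambda>z. (cis \<theta> + b z) / (cis \<theta> - b z)) holomorphic_on ball 0 1"
      using b1 cis_neq_disc by (intro holomorphic_intros b(1)) fastforce
    have re: "Re (complex_of_real (2 * pi) * w) = 2 * pi * Re w" for w by simp
    from has_integral_Re[OF mean_value_circle[OF hol s]]
    have "((\<lambda>t. Re ((cis \<theta> + b (of_real s * cis t)) / (cis \<theta> - b (of_real s * cis t))))
        has_integral 2 * pi * Re ((cis \<theta> + b 0) / (cis \<theta> - b 0))) {0..2*pi}"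
      unfolding re by simp
    then have "((\<lambda>t. poisson (b (of_real s * cis t)) \<theta>) has_integral 2 * pi * poisson (b 0) \<theta>) {0..2*pi}"
      using b1' b1[of 0] by (simp add: poisson_eq_Re)
    from integral_unique[OF this]
    show "integral {0..2*pi} (\<lambda>t. ?k t \<theta>) = 2 * pi * (poisson (b 0) \<theta> * norm (F (cis \<theta>)) powr p)"
      by simp
  qed
  also have "\<dots> = 2 * pi * integral {0..2*pi} (\<lambda>\<theta>. poisson (b 0) \<theta> * norm (F (cis \<theta>)) powr p)"
    by simp
  finally show ?thesis by simp
qed

lemma hardy_mean_nonneg: "0 \<le> hardy_mean p f r"
  unfolding hardy_mean_eq by (cases "(\<lambda>\<theta>. norm (f (of_real r * cis \<theta>)) powr p) integrable_on {0..2*pi}")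
    (auto intro!: divide_nonneg_nonneg integral_nonneg simp: not_integrable_integral)

lemma circle_powr_integrable:
  assumes "f holomorphic_on ball 0 1" "0 \<le> r" "r < 1" "0 < p"
  shows "(\<lambda>\<theta>. norm (f (of_real r * cis \<theta>)) powr p) integrable_on {0..2*pi}"
  using assms by (intro integrable_continuous_interval continuous_on_norm_powr continuous_on_circle)

text \<open>
  The subordination principle applies to the dilations of \<open>f\<close>; their means are continuous in the
  dilation parameter up to 1, because \<open>b\<close> maps the circle of radius \<open>s\<close> into a compact part of the disc.
\<close>

lemma hardy_mean_compose_le:
  assumes p: "1 < p" and f: "f holomorphic_on ball 0 1"
    and N: "\<And>r. 0 \<le> r \<Longrightarrow> r < 1 \<Longrightarrow> hardy_mean p f r \<le> N"
    and b: "b holomorphic_on ball 0 1" "b ` ball 0 1 \<subseteq> ball 0 1" and s: "0 \<le> s" "s < 1"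
  shows "hardy_mean p (f \<circ> b) s \<le> (1 + norm (b 0)) / (1 - norm (b 0)) * N"
proof -
  define K where "K = (1 + norm (b 0)) / (1 - norm (b 0))"
  have b1: "norm (b z) < 1" if "norm z < 1" for z using b(2) that by force
  then have b1': "norm (b (of_real s * cis t)) < 1" for t using s by (simp add: norm_mult)
  have b0: "norm (b 0) < 1" using b1[of 0] by simp
  then have K: "0 \<le> K" by (simp add: K_def)
  define I where "I r = integral (cbox 0 (2*pi)) (\<lambda>t. norm (f (of_real r * b (of_real s * cis t))) powr p)" for r :: real
  have cI: "continuous_on {0..1} I"
    unfolding I_def
  proof (rule integral_continuous_on_param)
    have "norm (of_real r * b (of_real s * cis t)) < 1" if "0 \<le> r" "r \<le> 1" for r t
    proof -
      have "r * norm (b (of_real s * cis t)) \<le> 1 * norm (b (of_real s * cis t))"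
        using that by (intro mult_right_mono) auto
      then show ?thesis using b1'[of t] that by (simp add: norm_mult)
    qed
    moreover have "continuous_on ({0..1} \<times> cbox 0 (2*pi)) (\<lambda>x. b (of_real s * cis (snd x)))"
      by (rule continuous_on_compose2[OF holomorphic_on_imp_continuous_on[OF b(1)]])
         (use s in \<open>auto intro!: continuous_intros simp: norm_mult\<close>)
    ultimately show "continuous_on ({0..1} \<times> cbox 0 (2*pi)) (\<lambda>(r, t). norm (f (of_real r * b (of_real s * cis t))) powr p)"
      unfolding case_prod_unfold using p
      by (intro continuous_on_norm_powr continuous_on_compose2[OF holomorphic_on_imp_continuous_on[OF f]])
         (auto intro!: continuous_intros)
  qed
  have le: "I r \<le> 2 * pi * (K * N)" if r: "r \<in> {0..<1}" for r
  proof -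
    have r': "0 \<le> r" "r < 1" using r by auto
    have cf: "continuous_on {0..2*pi} (\<lambda>\<theta>. f (of_real r * cis \<theta>))"
      by (rule continuous_on_circle[OF f r'])
    have "I r \<le> integral {0..2*pi} (\<lambda>\<theta>. poisson (b 0) \<theta> * norm (f (of_real r * cis \<theta>)) powr p)"
      using subordination[OF p holomorphic_on_dilate[OF f r'] _ b s] r' by (simp add: I_def cbox_interval)
    also have "\<dots> \<le> integral {0..2*pi} (\<lambda>\<theta>. K * norm (f (of_real r * cis \<theta>)) powr p)"
    proof (rule integral_le)
      show "(\<lambda>\<theta>. poisson (b 0) \<theta> * norm (f (of_real r * cis \<theta>)) powr p) integrable_on {0..2*pi}"
        using p b0 by (intro integrable_continuous_interval continuous_on_mult continuous_on_norm_powr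
            continuous_on_poisson cf continuous_intros) auto
      show "(\<lambda>\<theta>. K * norm (f (of_real r * cis \<theta>)) powr p) integrable_on {0..2*pi}"
        using p by (intro integrable_on_mult_right circle_powr_integrable f r') auto
    qed (use poisson_le[OF b0] in \<open>auto simp: K_def simp del: times_divide_eq_left intro!: mult_right_mono\<close>)
    also have "\<dots> = K * (2 * pi * hardy_mean p f r)"
      by (simp add: hardy_mean_eq)
    also have "\<dots> \<le> K * (2 * pi * N)"
      using N[OF r'] K by (intro mult_left_mono) auto
    finally show ?thesis by (simp add: mult_ac)
  qed
  have "I 1 \<le> 2 * pi * (K * N)"
  proof (rule continuous_le_on_closure[of "{0..<1}" I])
    show "continuous_on (closure {0..<1}) I" using cI by simp
  qed (use le in auto)
  then show ?thesis
    by (simp add: I_def K_def hardy_mean_eq cbox_interval o_def field_simps)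
qed

text \<open>
  Subordination for the self-map \<open>z \<mapsto> (r / t) z\<close>, which fixes 0.
\<close>

lemma hardy_mean_mono:
  assumes p: "1 < p" and f: "f holomorphic_on ball 0 1" and r: "0 \<le> r" "r \<le> t" "t < 1"
  shows "hardy_mean p f r \<le> hardy_mean p f t"
proof (cases "r = t")
  case False
  with r have t: "0 \<le> t" "0 < t" "t < 1" by auto
  have "integral {0..2*pi} (\<lambda>\<theta>. norm (f (of_real t * (of_real (r / t) * cis \<theta>))) powr p)
     \<le> integral {0..2*pi} (\<lambda>\<theta>. norm (f (of_real t * cis \<theta>)) powr p)"
    using subordination[OF p holomorphic_on_dilate[OF f t(1,3)], of "\<lambda>z. z" "r / t"] t r False
    by (auto simp: holomorphic_intros)
  moreover have "of_real t * (of_real (r / t) * cis \<theta>) = of_real r * cis \<theta>" for \<theta>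
    using t by simp
  ultimately show ?thesis by (simp add: hardy_mean_eq divide_right_mono)
qed auto

lemma hardy_spaceD:
  assumes "f \<in> hardy_space p"
  shows "f \<in> disc_analytic" "f holomorphic_on ball 0 1" "\<And>z. \<not> norm z < 1 \<Longrightarrow> f z = 0"
  using assms by (auto simp: hardy_space_def disc_analytic_def)

lemma hardy_mean_le_norm:
  assumes "f \<in> hardy_space p" "0 < p" "0 \<le> r" "r < 1"
  shows "hardy_mean p f r \<le> hardy_norm p f powr p"
proof -
  have "bdd_above (hardy_mean p f ` {0..<1})" using assms by (simp add: hardy_space_def)
  then have le: "hardy_mean p f r \<le> (SUP r\<in>{0..<1}. hardy_mean p f r)"
    using assms by (intro cSUP_upper) auto
  moreover have "0 \<le> (SUP r\<in>{0..<1}. hardy_mean p f r)"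
    using le hardy_mean_nonneg[of p f r] by linarith
  ultimately show ?thesis using assms by (simp add: hardy_norm_def powr_powr)
qed

lemma hardy_norm_nonneg: "0 \<le> hardy_norm p f"
  by (simp add: hardy_norm_def)

lemma hardy_norm_le:
  assumes "\<And>r. 0 \<le> r \<Longrightarrow> r < 1 \<Longrightarrow> hardy_mean p f r \<le> c powr p" "0 \<le> c" "0 < p"
  shows "hardy_norm p f \<le> c"
proof -
  have "(SUP r\<in>{0..<1}. hardy_mean p f r) \<le> c powr p"
    using assms by (intro cSUP_least) auto
  moreover have "0 \<le> (SUP r\<in>{0..<1}. hardy_mean p f r)"
  proof -
    have "hardy_mean p f 0 \<le> (SUP r\<in>{0..<1}. hardy_mean p f r)"
      using assms by (intro cSUP_upper bdd_aboveI[of _ "c powr p"]) auto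
    then show ?thesis using hardy_mean_nonneg[of p f 0] by linarith
  qed
  ultimately have "(SUP r\<in>{0..<1}. hardy_mean p f r) powr (1 / p) \<le> (c powr p) powr (1 / p)"
    using assms by (intro powr_mono2) auto
  then show ?thesis using assms by (simp add: hardy_norm_def powr_powr)
qed

lemma hardy_spaceI:
  assumes "f \<in> disc_analytic" "\<And>r. 0 \<le> r \<Longrightarrow> r < 1 \<Longrightarrow> hardy_mean p f r \<le> N"
  shows "f \<in> hardy_space p"
  using assms by (auto simp: hardy_space_def intro!: bdd_aboveI[of _ N])

lemma hardy_space_compose_norm:
  assumes "1 < p" "f \<in> hardy_space p" "b holomorphic_on ball 0 1" "b ` ball 0 1 \<subseteq> ball 0 1" "0 \<le> s" "s < 1"
  shows "hardy_mean p (f \<circ> b) s \<le> (1 + norm (b 0)) / (1 - norm (b 0)) * hardy_norm p f powr p"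
  using assms hardy_spaceD[OF assms(2)] by (intro hardy_mean_compose_le hardy_mean_le_norm) auto

text \<open>
  Subordination for a constant self-map of the disc.
\<close>

lemma hardy_point_bound:
  assumes "1 < p" "f \<in> hardy_space p" "norm z < 1"
  shows "norm (f z) powr p \<le> (1 + norm z) / (1 - norm z) * hardy_norm p f powr p"
  using hardy_space_compose_norm[OF assms(1,2), of "\<lambda>_. z" 0] assms
  by (simp add: hardy_mean_eq image_subset_iff)

lemma hardy_mean_dominated:
  assumes f: "f holomorphic_on ball 0 1" "g holomorphic_on ball 0 1" and p: "0 < p"
    and r: "0 \<le> r" "r < 1" and A: "0 \<le> A" and le: "\<And>z. norm z < 1 \<Longrightarrow> norm (f z) \<le> A * norm (g z)"
  shows "hardy_mean p f r \<le> A powr p * hardy_mean p g r"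
proof -
  have "integral {0..2*pi} (\<lambda>\<theta>. norm (f (of_real r * cis \<theta>)) powr p)
     \<le> integral {0..2*pi} (\<lambda>\<theta>. A powr p * norm (g (of_real r * cis \<theta>)) powr p)"
  proof (intro integral_le circle_powr_integrable integrable_on_mult_right)
    fix \<theta>
    have "norm (f (of_real r * cis \<theta>)) \<le> A * norm (g (of_real r * cis \<theta>))"
      using r by (intro le) (simp add: norm_mult)
    then have "norm (f (of_real r * cis \<theta>)) powr p \<le> (A * norm (g (of_real r * cis \<theta>))) powr p"
      using p by (intro powr_mono2) auto
    then show "norm (f (of_real r * cis \<theta>)) powr p \<le> A powr p * norm (g (of_real r * cis \<theta>)) powr p"
      using A by (simp add: powr_mult)
  qed (use assms in auto)
  then show ?thesis by (simp add: hardy_mean_eq divide_right_mono)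
qed

lemma hardy_mult_bounded:
  assumes p: "0 < p" and v: "v holomorphic_on ball 0 1" "\<And>z. norm z < 1 \<Longrightarrow> norm (v z) \<le> A"
    and f: "f \<in> hardy_space p"
  shows "(\<lambda>z. v z * f z) \<in> hardy_space p" "hardy_norm p (\<lambda>z. v z * f z) \<le> A * hardy_norm p f"
proof -
  note fD = hardy_spaceD[OF f]
  have A: "0 \<le> A" using order_trans[OF norm_ge_zero v(2)[of 0]] by simp
  have an: "(\<lambda>z. v z * f z) \<in> disc_analytic"
    using v(1) fD by (auto simp: disc_analytic_def intro!: holomorphic_intros)
  have m: "hardy_mean p (\<lambda>z. v z * f z) r \<le> (A * hardy_norm p f) powr p" if r: "0 \<le> r" "r < 1" for r
  proof -
    have "hardy_mean p (\<lambda>z. v z * f z) r \<le> A powr p * hardy_mean p f r"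
      using v(2) by (intro hardy_mean_dominated holomorphic_intros v(1) fD(2) p r A)
        (auto simp: norm_mult intro: mult_right_mono)
    also have "\<dots> \<le> A powr p * hardy_norm p f powr p"
      using hardy_mean_le_norm[OF f p r] by (intro mult_left_mono) auto
    finally show ?thesis using A hardy_norm_nonneg by (simp add: powr_mult)
  qed
  show "(\<lambda>z. v z * f z) \<in> hardy_space p" using hardy_spaceI[OF an m] .
  show "hardy_norm p (\<lambda>z. v z * f z) \<le> A * hardy_norm p f"
    using A hardy_norm_nonneg p by (intro hardy_norm_le m) auto
qed

lemma powr_add_le:
  fixes x y p :: real
  assumes "0 \<le> x" "0 \<le> y" "0 < p"
  shows "(x + y) powr p \<le> 2 powr p * (x powr p + y powr p)"
proof -
  have "(x + y) powr p \<le> (2 * max x y) powr p"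
    using assms by (intro powr_mono2) auto
  also have "\<dots> = 2 powr p * max x y powr p" using assms by (simp add: powr_mult)
  also have "max x y powr p \<le> x powr p + y powr p" by (auto simp: max_def)
  finally show ?thesis by simp
qed

lemma hardy_space_dominated:
  assumes p: "0 < p" and f: "f \<in> disc_analytic" and g: "g \<in> hardy_space p" and h: "h \<in> hardy_space p"
    and A: "0 \<le> A" and le: "\<And>z. norm z < 1 \<Longrightarrow> norm (f z) \<le> A * (norm (g z) + norm (h z))"
  shows "f \<in> hardy_space p"
proof (rule hardy_spaceI[OF f])
  note hol = hardy_spaceD(2)[OF g] hardy_spaceD(2)[OF h]
  fix r :: real assume r: "0 \<le> r" "r < 1"
  define C where "C = A powr p * 2 powr p"
  have "integral {0..2*pi} (\<lambda>\<theta>. norm (f (of_real r * cis \<theta>)) powr p)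
     \<le> integral {0..2*pi} (\<lambda>\<theta>. C * (norm (g (of_real r * cis \<theta>)) powr p + norm (h (of_real r * cis \<theta>)) powr p))"
  proof (intro integral_le circle_powr_integrable integrable_on_mult_right integrable_add hol)
    fix \<theta>
    have "norm (f (of_real r * cis \<theta>)) \<le> A * (norm (g (of_real r * cis \<theta>)) + norm (h (of_real r * cis \<theta>)))"
      using r by (intro le) (simp add: norm_mult)
    then have "norm (f (of_real r * cis \<theta>)) powr p \<le> (A * (norm (g (of_real r * cis \<theta>)) + norm (h (of_real r * cis \<theta>)))) powr p"
      using p by (intro powr_mono2) auto
    also have "\<dots> = A powr p * (norm (g (of_real r * cis \<theta>)) + norm (h (of_real r * cis \<theta>))) powr p"
      using A by (simp add: powr_mult)
    also have "\<dots> \<le> A powr p * (2 powr p * (norm (g (of_real r * cis \<theta>)) powr p + norm (h (of_real r * cis \<theta>)) powr p))"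
      using p by (intro mult_left_mono powr_add_le) auto
    finally show "norm (f (of_real r * cis \<theta>)) powr p
        \<le> C * (norm (g (of_real r * cis \<theta>)) powr p + norm (h (of_real r * cis \<theta>)) powr p)"
      by (simp add: C_def)
  qed (use f r p in \<open>auto simp: disc_analytic_def\<close>)
  also have "\<dots> = C * (integral {0..2*pi} (\<lambda>\<theta>. norm (g (of_real r * cis \<theta>)) powr p) + integral {0..2*pi} (\<lambda>\<theta>. norm (h (of_real r * cis \<theta>)) powr p))"
    using p by (simp add: integral_add circle_powr_integrable hol r)
  finally have "hardy_mean p f r \<le> C * (hardy_mean p g r + hardy_mean p h r)"
    by (simp add: hardy_mean_eq field_simps)
  also have "\<dots> \<le> C * (hardy_norm p g powr p + hardy_norm p h powr p)"
    using g h p r by (intro mult_left_mono add_mono hardy_mean_le_norm) (auto simp: C_def)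
  finally show "hardy_mean p f r \<le> C * (hardy_norm p g powr p + hardy_norm p h powr p)" .
qed

section \<open>Uniform convexity and dilations\<close>

text \<open>
  Add the strict tangent inequalities at the midpoint; the linear terms cancel.
\<close>

lemma powr_midpoint_less:
  fixes x y p :: real
  assumes p: "1 < p" and xy: "0 \<le> x" "0 \<le> y" "x \<noteq> y"
  shows "((x + y) / 2) powr p < (x powr p + y powr p) / 2"
proof -
  define s where "s = (x + y) / 2"
  have s: "0 < s" "x \<noteq> s" "y \<noteq> s" using xy by (auto simp: s_def)
  have "s powr p + p * s powr (p - 1) * (x - s) + (s powr p + p * s powr (p - 1) * (y - s)) < x powr p + y powr p"
    using powr_tangent_less[OF p xy(1) s(1,2)] powr_tangent_less[OF p xy(2) s(1,3)] by linarith
  moreover have "p * s powr (p - 1) * (x - s) + p * s powr (p - 1) * (y - s) = 0"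
    by (simp add: s_def flip: distrib_left)
  ultimately show ?thesis by (simp add: s_def)
qed

lemma norm_powr_midpoint_less:
  fixes a b :: complex
  assumes p: "1 < p" and ab: "a \<noteq> b"
  shows "norm ((a + b) / 2) powr p < (norm a powr p + norm b powr p) / 2"
proof (cases "norm a = norm b")
  case False
  have "norm ((a + b) / 2) powr p \<le> ((norm a + norm b) / 2) powr p"
    using p by (intro powr_mono2) (auto simp: norm_divide norm_triangle_ineq)
  also have "\<dots> < (norm a powr p + norm b powr p) / 2"
    using False p by (intro powr_midpoint_less) auto
  finally show ?thesis .
next
  case True
  have "(norm (a + b))\<^sup>2 + (norm (a - b))\<^sup>2 = 2 * (norm a)\<^sup>2 + 2 * (norm b)\<^sup>2"
    unfolding cmod_power2 by (simp add: power2_eq_square algebra_simps)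
  moreover have "0 < (norm (a - b))\<^sup>2" using ab by simp
  ultimately have "(norm (a + b))\<^sup>2 < (2 * norm a)\<^sup>2"
    using True by (simp add: power2_eq_square)
  then have "norm (a + b) < 2 * norm a" by (rule power_less_imp_less_base) simp
  then have "norm ((a + b) / 2) powr p < norm a powr p"
    using p by (intro powr_less_mono2) (auto simp: norm_divide)
  then show ?thesis using True by simp
qed

text \<open>
  A quantitative form of strict convexity in which both sides are homogeneous of degree \<open>p\<close>. On the compact
  part of the unit sphere where \<open>\<bar>a - b\<bar>\<^sup>p\<close> is not already dominated by the first term one has \<open>a \<noteq> b\<close>, so
  the convexity defect has a positive minimum there. Integrated over circles, the inequality says
  that two functions of nearly equal norm whose midpoint has nearly that norm are close.
\<close>

lemma uniform_convexity_powr: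
  fixes p \<epsilon> :: real
  assumes p: "1 < p" and \<epsilon>: "0 < \<epsilon>"
  obtains C where "0 \<le> C" "\<And>a b :: complex. norm (a - b) powr p \<le>
    \<epsilon> * (norm a powr p + norm b powr p) + C * ((norm a powr p + norm b powr p) / 2 - norm ((a + b) / 2) powr p)"
proof -
  define E where "E x = norm (fst x) powr p + norm (snd x) powr p" for x :: "complex \<times> complex"
  define D where "D x = E x / 2 - norm ((fst x + snd x) / 2) powr p" for x :: "complex \<times> complex"
  define G where "G x = norm (fst x - snd x) powr p" for x :: "complex \<times> complex"
  have cont: "continuous_on UNIV E" "continuous_on UNIV D" "continuous_on UNIV G"
    unfolding E_def D_def G_def using p
    by (intro continuous_on_diff continuous_on_add continuous_on_divide continuous_on_norm_powr
        continuous_on_fst continuous_on_snd continuous_on_id continuous_on_const; simp)+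
  have D0: "0 \<le> D x" for x
    using norm_powr_midpoint_less[OF p, of "fst x" "snd x"] by (cases "fst x = snd x") (auto simp: D_def E_def)
  define K where "K = sphere 0 1 \<inter> {x. \<epsilon> * E x \<le> G x}"
  have "closed {x. \<epsilon> * E x \<le> G x}"
    using cont by (intro closed_Collect_le continuous_intros) auto
  then have K: "compact K" unfolding K_def by (intro compact_Int_closed) auto
  obtain C where C: "0 \<le> C" "\<And>x. x \<in> sphere 0 1 \<Longrightarrow> G x \<le> \<epsilon> * E x + C * D x"
  proof (cases "K = {}")
    case True
    show ?thesis by (rule that[of 0]) (use True in \<open>auto simp: K_def not_le\<close>)
  next
    case False
    obtain x0 where x0: "x0 \<in> K" "\<And>x. x \<in> K \<Longrightarrow> D x0 \<le> D x"
      using continuous_attains_inf[OF K False] cont(2) continuous_on_subset by (metis subset_UNIV)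
    obtain x1 where x1: "x1 \<in> K" "\<And>x. x \<in> K \<Longrightarrow> G x \<le> G x1"
      using continuous_attains_sup[OF K False] cont(3) continuous_on_subset by (metis subset_UNIV)
    have E0: "0 < E x" if "x \<in> sphere 0 1" for x
    proof -
      have "fst x \<noteq> 0 \<or> snd x \<noteq> 0" using that by (cases x) (auto simp: norm_Pair)
      then show ?thesis by (auto simp: E_def add_pos_nonneg add_nonneg_pos)
    qed
    have "0 < D x0"
    proof -
      have "0 < \<epsilon> * E x0" using E0[of x0] x0(1) \<epsilon> by (auto simp: K_def)
      also have "\<dots> \<le> G x0" using x0(1) by (auto simp: K_def)
      finally have "fst x0 \<noteq> snd x0" by (auto simp: G_def)
      from norm_powr_midpoint_less[OF p this] show ?thesis by (simp add: D_def E_def)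
    qed
    show ?thesis
    proof (rule that[of "G x1 / D x0"])
      show "0 \<le> G x1 / D x0" using D0 by (simp add: G_def)
      fix x :: "complex \<times> complex" assume x: "x \<in> sphere 0 1"
      show "G x \<le> \<epsilon> * E x + G x1 / D x0 * D x"
      proof (cases "x \<in> K")
        case True
        have "G x \<le> G x1 / D x0 * D x0" using x1(2)[OF True] \<open>0 < D x0\<close> by simp
        also have "\<dots> \<le> G x1 / D x0 * D x"
          using x0(2)[OF True] D0[of x0] by (intro mult_left_mono) (auto simp: G_def)
        finally have "G x \<le> G x1 / D x0 * D x" .
        moreover have "0 \<le> \<epsilon> * E x" using E0[OF x] \<epsilon> by simp
        ultimately show ?thesis by linarith
      next
        case False
        then have "G x \<le> \<epsilon> * E x" using x by (auto simp: K_def)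
        moreover have "0 \<le> G x1 / D x0 * D x" using D0 by (simp add: G_def)
        ultimately show ?thesis by simp
      qed
    qed
  qed
  show ?thesis
  proof (rule that[OF C(1)])
    fix a b :: complex
    define t where "t = norm (a, b)"
    show "norm (a - b) powr p \<le>
      \<epsilon> * (norm a powr p + norm b powr p) + C * ((norm a powr p + norm b powr p) / 2 - norm ((a + b) / 2) powr p)"
    proof (cases "t = 0")
      case True
      then show ?thesis by (simp add: t_def zero_prod_def)
    next
      case False
      then have t: "0 < t" by (simp add: t_def)
      define x where "x = (1 / t) *\<^sub>R (a, b)"
      have "norm x = 1" using t unfolding x_def norm_scaleR t_def[symmetric] by simp
      then have "G x \<le> \<epsilon> * E x + C * D x" by (intro C(2)) simp
      then have "t powr p * G x \<le> t powr p * (\<epsilon> * E x + C * D x)"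
        by (intro mult_left_mono) auto
      moreover have "t powr p * G x = norm (a - b) powr p"
        using t by (simp add: G_def x_def powr_mult flip: scaleR_diff_right) (simp add: powr_divide)
      moreover have e: "t powr p * E x = norm a powr p + norm b powr p"
        using t by (simp add: E_def x_def powr_mult powr_divide field_simps)
      moreover have "t powr p * norm ((fst x + snd x) / 2) powr p = norm ((a + b) / 2) powr p"
      proof -
        have "(fst x + snd x) / 2 = (1 / t) *\<^sub>R ((a + b) / 2)"
          using t by (simp add: x_def scaleR_conv_of_real field_simps)
        then have "norm ((fst x + snd x) / 2) = norm ((a + b) / 2) / t" using t by (simp only: norm_scaleR) simp
        then show ?thesis using t by (simp only: powr_divide) simp
      qed
      ultimately show ?thesis
        by (simp add: D_def right_diff_distrib distrib_left mult.left_commute[of "t powr p"])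
    qed
  qed
qed

definition dilate :: "real \<Rightarrow> (complex \<Rightarrow> complex) \<Rightarrow> complex \<Rightarrow> complex" where
  "dilate r f = (\<lambda>z. if norm z < 1 then f (of_real r * z) else 0)"

lemma disc_analyticI:
  assumes "g holomorphic_on ball 0 1"
  shows "(\<lambda>z. if norm z < 1 then g z else 0) \<in> disc_analytic"
  using holomorphic_transform[OF assms, of "\<lambda>z. if norm z < 1 then g z else 0"]
  by (simp add: disc_analytic_def)

lemma hardy_mean_cong:
  assumes "\<And>z. norm z < 1 \<Longrightarrow> f z = g z" "0 \<le> r" "r < 1"
  shows "hardy_mean p f r = hardy_mean p g r"
  unfolding hardy_mean_def using assms by (simp add: norm_mult)

lemma hardy_norm_approx:
  assumes f: "f \<in> hardy_space p" and p: "0 < p" and \<eta>: "0 < \<eta>"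
  obtains t where "0 \<le> t" "t < 1" "hardy_norm p f powr p - \<eta> < hardy_mean p f t"
proof -
  have bdd: "bdd_above (hardy_mean p f ` {0..<1})" using f by (simp add: hardy_space_def)
  define S where "S = (SUP r\<in>{0..<1}. hardy_mean p f r)"
  have "hardy_mean p f 0 \<le> S" unfolding S_def using bdd by (intro cSUP_upper) auto
  then have "0 \<le> S" using hardy_mean_nonneg[of p f 0] by linarith
  then have S: "hardy_norm p f powr p = S" using p by (simp add: hardy_norm_def powr_powr S_def)
  have "S - \<eta> < (SUP r\<in>{0..<1}. hardy_mean p f r)" using \<eta> by (simp add: S_def)
  then obtain t where "t \<in> {0..<1}" "S - \<eta> < hardy_mean p f t"
    using bdd by (subst (asm) less_cSUP_iff) auto
  then show ?thesis using that S by auto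
qed

text \<open>
  The dilation \<open>f\<^sub>r\<close> has norm at most \<open>\<parallel>f\<parallel>\<close>. On a circle of radius \<open>t0\<close> where
  the mean of \<open>f\<close> is almost \<open>\<parallel>f\<parallel>\<^sup>p\<close> the mean of \<open>(f + f\<^sub>r) / 2\<close> is almost \<open>\<parallel>f\<parallel>\<^sup>p\<close> too as soon as \<open>r\<close> is
  close to 1, and by monotonicity also on all larger circles. Uniform convexity then bounds \<open>f - f\<^sub>r\<close>.
\<close>

lemma dilate_tendsto:
  assumes p: "1 < p" and f: "f \<in> hardy_space p" and \<delta>: "0 < \<delta>"
  obtains r where "0 < r" "r < 1" "hardy_norm p (\<lambda>z. f z - dilate r f z) \<le> \<delta>"
proof -
  have p0: "0 < p" using p by simp
  note fh = hardy_spaceD(2)[OF f]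
  define S where "S = hardy_norm p f powr p"
  have S0: "0 \<le> S" by (simp add: S_def)
  define d where "d = \<delta> powr p"
  have d0: "0 < d" using \<delta> by (simp add: d_def)
  \<comment> \<open>Each of the two error terms will contribute at most \<open>d / 2\<close>.\<close>
  define \<epsilon> where "\<epsilon> = d / (4 * (S + 1))"
  have \<epsilon>: "0 < \<epsilon>" "\<epsilon> * (2 * S) \<le> d / 2"
    using d0 S0 by (auto simp: \<epsilon>_def field_simps)
  obtain C where C: "0 \<le> C" "\<And>a b :: complex. norm (a - b) powr p \<le>
    \<epsilon> * (norm a powr p + norm b powr p) + C * ((norm a powr p + norm b powr p) / 2 - norm ((a + b) / 2) powr p)"
    using uniform_convexity_powr[OF p \<epsilon>(1)] by blast
  define \<eta> where "\<eta> = d / (2 * (C + 1))"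
  have \<eta>: "0 < \<eta>" "C * \<eta> \<le> d / 2"
    using d0 C(1) by (auto simp: \<eta>_def field_simps)
  obtain t0 where t0: "0 \<le> t0" "t0 < 1" "S - \<eta> / 2 < hardy_mean p f t0"
    using hardy_norm_approx[OF f p0, of "\<eta> / 2"] \<eta> by (auto simp: S_def)
  define J where "J r = integral (cbox 0 (2*pi)) (\<lambda>\<theta>. norm ((f (of_real t0 * cis \<theta>) + f (of_real r * (of_real t0 * cis \<theta>))) / 2) powr p)"
    for r :: real
  have cJ: "continuous_on {0..1} J"
    unfolding J_def
  proof (rule integral_continuous_on_param)
    have "r * t0 < 1" if "0 \<le> r" "r \<le> 1" for r :: real
      using that t0 mult_mono[of r 1 t0 t0] by auto
    then show "continuous_on ({0..1} \<times> cbox 0 (2*pi)) (\<lambda>(r, \<theta>). norm ((f (of_real t0 * cis \<theta>) + f (of_real r * (of_real t0 * cis \<theta>))) / 2) powr p)"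
      unfolding case_prod_unfold using p t0
      by (intro continuous_on_norm_powr continuous_on_divide continuous_on_add
            continuous_on_compose2[OF holomorphic_on_imp_continuous_on[OF fh]])
         (auto intro!: continuous_intros simp: norm_mult)
  qed
  have J1: "J 1 = 2 * pi * hardy_mean p f t0"
    by (simp add: J_def hardy_mean_eq cbox_interval)
  obtain e where e: "0 < e" "\<And>r. r \<in> {0..1} \<Longrightarrow> \<bar>r - 1\<bar> < e \<Longrightarrow> \<bar>J r - J 1\<bar> < 2 * pi * (\<eta> / 2)"
  proof -
    have "1 \<in> {0..1::real}" "0 < 2 * pi * (\<eta> / 2)" using \<eta>(1) by auto
    from bspec[OF cJ[unfolded continuous_on_iff], rule_format, OF this]
    show ?thesis using that unfolding dist_real_def by blast
  qed
  define r where "r = 1 - min (e / 2) (1 / 2)"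
  have r: "0 < r" "r < 1" using e(1) by (auto simp: r_def min_def)
  have Jr: "2 * pi * (S - \<eta>) < J r"
  proof -
    have "\<bar>J r - J 1\<bar> < 2 * pi * (\<eta> / 2)" using e(1) r by (intro e(2)) (auto simp: r_def)
    moreover have "2 * pi * (S - \<eta> / 2) < J 1"
      unfolding J1 using t0(3) by (intro mult_strict_left_mono) auto
    ultimately show ?thesis by (simp add: algebra_simps)
  qed
  have hd: "(\<lambda>z. f (of_real r * z)) holomorphic_on ball 0 1"
    using holomorphic_on_dilate_disc[OF fh, of r] r by simp
  have mid: "S - \<eta> < hardy_mean p (\<lambda>z. (f z + f (of_real r * z)) / 2) t" if t: "t0 \<le> t" "t < 1" for t
  proof -
    have "S - \<eta> < hardy_mean p (\<lambda>z. (f z + f (of_real r * z)) / 2) t0"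
      using Jr by (simp add: J_def hardy_mean_eq cbox_interval field_simps)
    also have "\<dots> \<le> hardy_mean p (\<lambda>z. (f z + f (of_real r * z)) / 2) t"
      using t t0 by (intro hardy_mean_mono p holomorphic_intros fh hd) auto
    finally show ?thesis .
  qed
  have main: "hardy_mean p (\<lambda>z. f z - f (of_real r * z)) t \<le> d" if t: "t0 \<le> t" "t < 1" for t
  proof -
    have t': "0 \<le> t" "t < 1" using t t0 by auto
    let ?a = "\<lambda>\<theta>. norm (f (of_real t * cis \<theta>)) powr p"
    let ?b = "\<lambda>\<theta>. norm (f (of_real r * (of_real t * cis \<theta>))) powr p"
    let ?m = "\<lambda>\<theta>. norm ((f (of_real t * cis \<theta>) + f (of_real r * (of_real t * cis \<theta>))) / 2) powr p"
    have ia: "?a integrable_on {0..2*pi}" by (rule circle_powr_integrable[OF fh t' p0])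
    have ib: "?b integrable_on {0..2*pi}" by (rule circle_powr_integrable[OF hd t' p0])
    have im: "?m integrable_on {0..2*pi}"
      by (rule circle_powr_integrable[of "\<lambda>z. (f z + f (of_real r * z)) / 2", OF _ t' p0]) (intro holomorphic_intros fh hd, simp)
    have I: "((\<lambda>\<theta>. \<epsilon> * (?a \<theta> + ?b \<theta>) + C * ((?a \<theta> + ?b \<theta>) / 2 - ?m \<theta>)) has_integral
       (\<epsilon> * (integral {0..2*pi} ?a + integral {0..2*pi} ?b) +
        C * ((integral {0..2*pi} ?a + integral {0..2*pi} ?b) / 2 - integral {0..2*pi} ?m))) {0..2*pi}"
      by (intro has_integral_add has_integral_mult_right has_integral_diff has_integral_divide integrable_integral ia ib im)
    have "integral {0..2*pi} (\<lambda>\<theta>. norm (f (of_real t * cis \<theta>) - f (of_real r * (of_real t * cis \<theta>))) powr p)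
      \<le> integral {0..2*pi} (\<lambda>\<theta>. \<epsilon> * (?a \<theta> + ?b \<theta>) + C * ((?a \<theta> + ?b \<theta>) / 2 - ?m \<theta>))"
    proof (rule integral_le)
      show "(\<lambda>\<theta>. norm (f (of_real t * cis \<theta>) - f (of_real r * (of_real t * cis \<theta>))) powr p) integrable_on {0..2*pi}"
        by (rule circle_powr_integrable[of "\<lambda>z. f z - f (of_real r * z)", OF _ t' p0]) (intro holomorphic_intros fh hd)
    qed (use I C(2) in auto)
    then have X: "integral {0..2*pi} (\<lambda>\<theta>. norm (f (of_real t * cis \<theta>) - f (of_real r * (of_real t * cis \<theta>))) powr p) / (2 * pi)
      \<le> integral {0..2*pi} (\<lambda>\<theta>. \<epsilon> * (?a \<theta> + ?b \<theta>) + C * ((?a \<theta> + ?b \<theta>) / 2 - ?m \<theta>)) / (2 * pi)"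
      by (rule divide_right_mono) simp
    have "(e * (x + y) + c * ((x + y) / 2 - m)) / k = e * (x / k + y / k) + c * ((x / k + y / k) / 2 - m / k)"
      for e x y c m k :: real
      by (simp add: algebra_simps add_divide_distrib diff_divide_distrib)
    with X have "hardy_mean p (\<lambda>z. f z - f (of_real r * z)) t \<le>
        \<epsilon> * (hardy_mean p f t + hardy_mean p (\<lambda>z. f (of_real r * z)) t) +
        C * ((hardy_mean p f t + hardy_mean p (\<lambda>z. f (of_real r * z)) t) / 2 - hardy_mean p (\<lambda>z. (f z + f (of_real r * z)) / 2) t)"
      unfolding integral_unique[OF I] hardy_mean_eq by simp
    also have "\<dots> \<le> \<epsilon> * (S + S) + C * ((S + S) / 2 - (S - \<eta>))"
    proof -
      have 1: "hardy_mean p f t \<le> S" unfolding S_def by (rule hardy_mean_le_norm[OF f p0 t'])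
      have rt: "0 \<le> r * t" "r * t < 1" using r t' mult_strict_mono[of r 1 t 1] by auto
      have "hardy_mean p f (r * t) \<le> S" unfolding S_def by (rule hardy_mean_le_norm[OF f p0 rt])
      then have 2: "hardy_mean p (\<lambda>z. f (of_real r * z)) t \<le> S" by (simp add: hardy_mean_eq mult.assoc)
      show ?thesis using 1 2 mid[OF t] \<epsilon>(1) C(1)
        by (intro add_mono mult_left_mono diff_mono divide_right_mono) auto
    qed
    also have "\<dots> \<le> d" using \<epsilon>(2) \<eta>(2) by simp
    finally show ?thesis .
  qed
  have "hardy_mean p (\<lambda>z. f z - dilate r f z) t \<le> \<delta> powr p" if t: "0 \<le> t" "t < 1" for t
  proof -
    have "hardy_mean p (\<lambda>z. f z - dilate r f z) t = hardy_mean p (\<lambda>z. f z - f (of_real r * z)) t"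
      using t by (intro hardy_mean_cong) (auto simp: dilate_def)
    also have "\<dots> \<le> hardy_mean p (\<lambda>z. f z - f (of_real r * z)) (max t t0)"
      using t t0 by (intro hardy_mean_mono p holomorphic_intros fh hd) auto
    also have "\<dots> \<le> d" using t t0 by (intro main) auto
    finally show ?thesis by (simp add: d_def)
  qed
  then have "hardy_norm p (\<lambda>z. f z - dilate r f z) \<le> \<delta>" using \<delta> p0 by (intro hardy_norm_le) auto
  then show ?thesis using that r by blast
qed

section \<open>Density of polynomials, test functions and difference quotients\<close>

lemma dilate_polynomial_approx:
  fixes f :: "complex \<Rightarrow> complex"
  assumes f: "f holomorphic_on ball 0 1" and r: "0 < r" "r < 1" and \<delta>: "0 < \<delta>"
  obtains N c where "\<And>z. norm z < 1 \<Longrightarrow> norm (f (of_real r * z) - (\<Sum>k<N. c k * z ^ k)) \<le> \<delta>"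
proof -
  define a where "a n = (deriv ^^ n) f 0 / fact n" for n
  define c where "c n = a n * of_real r ^ n" for n
  have sums: "(\<lambda>n. a n * w ^ n) sums f w" if "norm w < 1" for w
    using holomorphic_power_series[OF f, of w] that by (simp add: a_def)
  have "norm (complex_of_real ((1 + r) / 2)) = (1 + r) / 2"
    using r by (simp only: norm_of_real) simp
  then have x: "norm (complex_of_real ((1 + r) / 2)) < 1" "norm (complex_of_real r) < norm (complex_of_real ((1 + r) / 2))"
    using r by auto
  have summ: "summable (\<lambda>n. norm (c n))"
    unfolding c_def using powser_insidea[OF sums_summable[OF sums[OF x(1)]] x(2)] .
  have "uniform_limit (ball 0 1) (\<lambda>n z. \<Sum>i<n. c i * z ^ i) (\<lambda>z. suminf (\<lambda>i. c i * z ^ i)) sequentially"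
  proof (rule Weierstrass_m_test[OF _ summ])
    fix n and z :: complex assume "z \<in> ball 0 1"
    then have "norm z ^ n \<le> 1" by (intro power_le_one) auto
    then show "norm (c n * z ^ n) \<le> norm (c n)"
      by (simp add: norm_mult norm_power mult_left_le)
  qed
  from eventually_sequentially[THEN iffD1, OF uniform_limitD[OF this \<delta>]] obtain N
    where N: "\<And>z. z \<in> ball 0 1 \<Longrightarrow> dist (\<Sum>i<N. c i * z ^ i) (suminf (\<lambda>i. c i * z ^ i)) < \<delta>" by blast
  show ?thesis
  proof (rule that[where N = N and c = c])
    fix z :: complex assume z: "norm z < 1"
    have "norm (of_real r * z) < 1"
      using z r mult_strict_mono[of r 1 "norm z" 1] by (simp add: norm_mult)
    from sums_unique[OF sums[OF this]] have "f (of_real r * z) = suminf (\<lambda>i. c i * z ^ i)"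
      by (simp add: c_def power_mult_distrib mult_ac)
    then show "norm (f (of_real r * z) - (\<Sum>k<N. c k * z ^ k)) \<le> \<delta>"
      using N[of z] z by (simp add: dist_norm norm_minus_commute)
  qed
qed

definition disc_one :: "complex \<Rightarrow> complex" where
  "disc_one = (\<lambda>z. if norm z < 1 then 1 else 0)"

lemma disc_one: "0 < p \<Longrightarrow> disc_one \<in> hardy_space p" "0 < p \<Longrightarrow> hardy_norm p disc_one \<le> 1"
proof -
  have m: "hardy_mean p disc_one r \<le> 1 powr p" if "0 \<le> r" "r < 1" for r
    using that by (simp add: hardy_mean_eq disc_one_def norm_mult)
  have "disc_one \<in> disc_analytic" unfolding disc_one_def by (intro disc_analyticI) simp
  then show "disc_one \<in> hardy_space p" using m by (rule hardy_spaceI)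
  show "hardy_norm p disc_one \<le> 1" if "0 < p" using m that by (intro hardy_norm_le) auto
qed

lemma hardy_norm_bounded:
  assumes p: "0 < p" and g: "g \<in> disc_analytic" "\<And>z. norm z < 1 \<Longrightarrow> norm (g z) \<le> A"
  shows "g \<in> hardy_space p" "hardy_norm p g \<le> A"
proof -
  have gD: "g holomorphic_on ball 0 1" "\<And>z. \<not> norm z < 1 \<Longrightarrow> g z = 0"
    using g(1) by (auto simp: disc_analytic_def)
  have e: "(\<lambda>z. g z * disc_one z) = g" using gD by (auto simp: disc_one_def)
  note * = hardy_mult_bounded[OF p gD(1) g(2) disc_one(1)[OF p], unfolded e]
  show "g \<in> hardy_space p" using *(1) .
  have "0 \<le> A" using order_trans[OF norm_ge_zero g(2)[of 0]] by simp
  then have "A * hardy_norm p disc_one \<le> A" using disc_one(2)[OF p] by (simp add: mult_left_le)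
  then show "hardy_norm p g \<le> A" using *(2) by linarith
qed

lemma dilate_in_disc_analytic:
  assumes "f holomorphic_on ball 0 1" "0 \<le> r" "r < 1"
  shows "dilate r f \<in> disc_analytic"
  unfolding dilate_def by (intro disc_analyticI holomorphic_on_dilate_disc assms)

lemma dilate_in_hardy_space:
  assumes f: "f \<in> hardy_space p" and p: "0 < p" and r: "0 < r" "r < 1"
  shows "dilate r f \<in> hardy_space p"
proof (rule hardy_spaceI[OF dilate_in_disc_analytic])
  show "f holomorphic_on ball 0 1" by (rule hardy_spaceD(2)[OF f])
  show "hardy_mean p (dilate r f) t \<le> hardy_norm p f powr p" if t: "0 \<le> t" "t < 1" for t
  proof -
    have "hardy_mean p (dilate r f) t = hardy_mean p (\<lambda>z. f (of_real r * z)) t"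
      using t by (intro hardy_mean_cong) (auto simp: dilate_def)
    also have "\<dots> = hardy_mean p f (r * t)" by (simp add: hardy_mean_eq mult.assoc)
    also have "\<dots> \<le> hardy_norm p f powr p"
      using r t mult_strict_mono[of r 1 t 1] by (intro hardy_mean_le_norm f p) auto
    finally show ?thesis .
  qed
qed (use r in auto)

lemma disc_analytic_diff:
  "f \<in> disc_analytic \<Longrightarrow> g \<in> disc_analytic \<Longrightarrow> (\<lambda>z. f z - g z) \<in> disc_analytic"
  unfolding disc_analytic_def by (auto intro: holomorphic_on_diff)

text \<open>
  Density of the polynomials, in the form in which it is used: a norm closed set containing them
  first contains all dilations, by their Taylor series, and then everything.
\<close>

theorem hardy_space_subset_closed:
  assumes p: "1 < p"
    and closed: "\<And>f. f \<in> hardy_space p \<Longrightarrow>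
      (\<And>\<delta>. 0 < \<delta> \<Longrightarrow> \<exists>g\<in>S. hardy_norm p (\<lambda>z. f z - g z) \<le> \<delta>) \<Longrightarrow> f \<in> S"
    and poly: "\<And>N c. (\<lambda>z. if norm z < 1 then \<Sum>k<N. c k * z ^ k else 0) \<in> S"
  shows "hardy_space p \<subseteq> S"
proof -
  have p0: "0 < p" using p by simp
  have dil: "dilate r f \<in> S" if f: "f \<in> hardy_space p" and r: "0 < r" "r < 1" for f r
  proof (rule closed[OF dilate_in_hardy_space[OF f p0 r]])
    fix \<delta> :: real assume \<delta>: "0 < \<delta>"
    have fh: "f holomorphic_on ball 0 1" by (rule hardy_spaceD(2)[OF f])
    obtain N c where c: "\<And>z. norm z < 1 \<Longrightarrow> norm (f (of_real r * z) - (\<Sum>k<N. c k * z ^ k)) \<le> \<delta>"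
      using dilate_polynomial_approx[OF fh r \<delta>] by blast
    let ?g = "\<lambda>z. if norm z < 1 then \<Sum>k<N. c k * z ^ k else 0"
    have "hardy_norm p (\<lambda>z. dilate r f z - ?g z) \<le> \<delta>"
    proof (rule hardy_norm_bounded[OF p0])
      have "?g \<in> disc_analytic" by (intro disc_analyticI holomorphic_intros)
      then show "(\<lambda>z. dilate r f z - ?g z) \<in> disc_analytic"
        using r by (intro disc_analytic_diff dilate_in_disc_analytic[OF fh]) auto
    qed (use c in \<open>auto simp: dilate_def\<close>)
    then show "\<exists>g\<in>S. hardy_norm p (\<lambda>z. dilate r f z - g z) \<le> \<delta>" by (intro bexI[of _ ?g] poly)
  qed
  show ?thesis
  proof
    fix f assume f: "f \<in> hardy_space p"
    show "f \<in> S"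
    proof (rule closed[OF f])
      fix \<delta> :: real assume "0 < \<delta>"
      then obtain r where "0 < r" "r < 1" "hardy_norm p (\<lambda>z. f z - dilate r f z) \<le> \<delta>"
        by (rule dilate_tendsto[OF p f])
      then show "\<exists>g\<in>S. hardy_norm p (\<lambda>z. f z - g z) \<le> \<delta>" using dil[OF f] by blast
    qed
  qed
qed

text \<open>
  The function \<open>(1 - cnj w \<cdot> z) powr (-2 / p)\<close>: on the circle of radius \<open>r\<close> its \<open>p\<close>-th power in absolute
  value is \<open>poisson (r w) / (1 - \<bar>r w\<bar>\<^sup>2)\<close>. Up to a constant it has the largest value at \<open>w\<close> that the growth
  estimate permits.
\<close>

lemma hardy_test_function:
  assumes p: "1 < p" and w: "norm w < 1"
  obtains g where "g \<in> hardy_space p" "hardy_norm p g powr p \<le> 1 / (1 - (norm w)\<^sup>2)"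
    "norm (g w) powr p = 1 / (1 - (norm w)\<^sup>2)\<^sup>2"
proof -
  define g where "g = (\<lambda>z. if norm z < 1 then (1 - cnj w * z) powr of_real (-2 / p) else 0)"
  have less: "norm (cnj w * z) < 1" if "norm z < 1" for z
    using w that mult_strict_mono[of "norm w" 1 "norm z" 1] by (simp add: norm_mult)
  have re: "0 < Re (1 - cnj w * z)" if "norm z < 1" for z
    using less[OF that] complex_Re_le_cmod[of "cnj w * z"] by simp
  then have notin: "1 - cnj w * z \<notin> \<real>\<^sub>\<le>\<^sub>0" if "norm z < 1" for z
    using re[OF that] by (auto simp: complex_nonpos_Reals_iff)
  have an: "g \<in> disc_analytic"
    unfolding g_def using notin by (intro disc_analyticI holomorphic_intros) auto
  have npow: "norm (g z) powr p = 1 / (norm (1 - cnj w * z))\<^sup>2" if z: "norm z < 1" for z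
  proof -
    have pos: "0 < norm (1 - cnj w * z)" using notin[OF z] by auto
    have "norm (g z) = norm (1 - cnj w * z) powr (-2 / p)"
      using z unfolding g_def by (simp add: norm_powr_real_powr' del: of_real_divide of_real_minus)
    then have "norm (g z) powr p = norm (1 - cnj w * z) powr (-2)"
      using p by (simp add: powr_powr)
    also have "\<dots> = 1 / (norm (1 - cnj w * z))\<^sup>2"
      using pos by (simp add: powr_minus powr_numeral divide_inverse)
    finally show ?thesis .
  qed
  have w2: "(norm w)\<^sup>2 < 1" using w by (simp add: power_less_one_iff abs_square_less_1)
  have m: "hardy_mean p g r \<le> 1 / (1 - (norm w)\<^sup>2)" if r: "0 \<le> r" "r < 1" for r
  proof -
    have rw: "norm (of_real r * w) < 1" using less[of "of_real r"] r by (simp add: norm_mult mult.commute)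
    have "(norm (of_real r * w))\<^sup>2 \<le> (norm w)\<^sup>2"
      using r by (intro power_mono) (auto simp: norm_mult mult_left_le_one_le)
    then have le: "1 - (norm w)\<^sup>2 \<le> 1 - (norm (of_real r * w))\<^sup>2" by simp
    have "norm (g (of_real r * cis \<theta>)) powr p = poisson (of_real r * w) \<theta> / (1 - (norm (of_real r * w))\<^sup>2)" for \<theta>
    proof -
      have "cnj (1 - cnj w * (of_real r * cis \<theta>)) = cnj (cis \<theta>) * (cis \<theta> - of_real r * w)"
        by (simp add: algebra_simps cis_cnj cis_mult)
      then have "norm (1 - cnj w * (of_real r * cis \<theta>)) = norm (cis \<theta> - of_real r * w)"
        by (metis complex_mod_cnj norm_cis norm_mult mult_1)
      moreover have "norm (g (of_real r * cis \<theta>)) powr p = 1 / (norm (1 - cnj w * (of_real r * cis \<theta>)))\<^sup>2"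
        using r by (intro npow) (simp add: norm_mult)
      moreover have "1 - (norm (of_real r * w))\<^sup>2 \<noteq> 0" using le w2 by linarith
      ultimately show ?thesis by (simp add: poisson_def)
    qed
    then have "hardy_mean p g r = integral {0..2*pi} (poisson (of_real r * w)) / (1 - (norm (of_real r * w))\<^sup>2) / (2 * pi)"
      unfolding hardy_mean_eq by (simp only: integral_divide)
    also have "\<dots> = 1 / (1 - (norm (of_real r * w))\<^sup>2)"
      unfolding integral_unique[OF poisson_has_integral[OF rw]] by simp
    also have "\<dots> \<le> 1 / (1 - (norm w)\<^sup>2)" using le w2 by (intro frac_le) auto
    finally show ?thesis .
  qed
  have p0: "0 < p" using p by simp
  let ?c = "(1 / (1 - (norm w)\<^sup>2)) powr (1 / p)"
  have c: "?c powr p = 1 / (1 - (norm w)\<^sup>2)" using p w2 by (simp add: powr_powr)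
  have "hardy_norm p g \<le> ?c" using m c by (intro hardy_norm_le p0) auto
  then have "hardy_norm p g powr p \<le> ?c powr p" using p0 hardy_norm_nonneg by (intro powr_mono2) auto
  moreover have "norm (1 - cnj w * w) = 1 - (norm w)\<^sup>2"
  proof -
    have "1 - cnj w * w = of_real (1 - (norm w)\<^sup>2)" by (simp add: complex_norm_square mult.commute del: of_real_power)
    then show ?thesis using w2 by (simp only: norm_of_real)
  qed
  ultimately show ?thesis
    using that[OF hardy_spaceI[OF an m]] c npow[OF w] by simp
qed

text \<open>
  The quotient \<open>(f z - f w) / (z - w)\<close> is bounded near \<open>w\<close> and at most a constant multiple of \<open>\<bar>f z\<bar> + 1\<close>
  away from \<open>w\<close>.
\<close>

lemma hardy_difference_quotient:
  assumes p: "0 < p" and f: "f \<in> hardy_space p" and w: "norm w < 1"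
  obtains h where "h \<in> hardy_space p" "\<And>z. norm z < 1 \<Longrightarrow> f z = f w + (z - w) * h z"
proof -
  note fh = hardy_spaceD(2)[OF f]
  define q where "q = (\<lambda>z. if z = w then deriv f w else (f z - f w) / (z - w))"
  have qh: "q holomorphic_on ball 0 1"
    unfolding q_def by (rule pole_lemma[OF fh]) (use w in simp)
  define h where "h = (\<lambda>z. if norm z < 1 then q z else 0)"
  have han: "h \<in> disc_analytic" unfolding h_def by (rule disc_analyticI[OF qh])
  define \<rho> where "\<rho> = (1 + norm w) / 2"
  have \<rho>: "norm w < \<rho>" "\<rho> < 1" using w by (auto simp: \<rho>_def)
  have "compact (q ` cball 0 \<rho>)"
    by (intro compact_continuous_image holomorphic_on_imp_continuous_on holomorphic_on_subset[OF qh])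
       (use \<rho> in auto)
  then have "bounded (q ` cball 0 \<rho>)" by (rule compact_imp_bounded)
  then obtain M where M0: "0 < M" "\<forall>y \<in> q ` cball 0 \<rho>. norm y \<le> M" unfolding bounded_pos by blast
  then have M: "0 < M" "norm (q z) \<le> M" if "norm z \<le> \<rho>" for z using that by auto
  define D where "D = \<rho> - norm w"
  have D: "0 < D" using \<rho> by (simp add: D_def)
  define A where "A = M + (1 + norm (f w)) / D"
  have A: "0 \<le> A" using M0(1) D by (simp add: A_def)
  have "norm (h z) \<le> A * (norm (f z) + norm (disc_one z))" if z: "norm z < 1" for z
  proof (cases "norm z \<le> \<rho>")
    case True
    have "norm (h z) \<le> M" using M True z by (simp add: h_def)
    also have "\<dots> \<le> A" using D by (simp add: A_def)
    also have "\<dots> \<le> A * (norm (f z) + norm (disc_one z))"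
      using A z mult_left_mono[of 1 "norm (f z) + 1" A] by (simp add: disc_one_def)
    finally show ?thesis .
  next
    case False
    then have zw: "D \<le> norm (z - w)" using norm_triangle_ineq2[of z w] by (simp add: D_def)
    have ne: "z \<noteq> w" using zw D by auto
    have "norm (h z) = norm (f z - f w) / norm (z - w)" using z ne by (simp add: h_def q_def norm_divide)
    also have "\<dots> \<le> (norm (f z) + norm (f w)) / D"
      using zw D by (intro frac_le norm_triangle_ineq4) auto
    also have "\<dots> \<le> (1 + norm (f w)) * (norm (f z) + 1) / D"
      using D by (intro divide_right_mono) (auto simp: algebra_simps)
    also have "\<dots> = (1 + norm (f w)) / D * (norm (f z) + 1)" by simp
    also have "\<dots> \<le> A * (norm (f z) + norm (disc_one z))"
      using M0(1) z D by (intro mult_mono) (auto simp: A_def disc_one_def)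
    finally show ?thesis .
  qed
  then have "h \<in> hardy_space p"
    by (rule hardy_space_dominated[OF p han f disc_one(1)[OF p] A])
  moreover have "f z = f w + (z - w) * h z" if "norm z < 1" for z
    using that by (auto simp: h_def q_def)
  ultimately show ?thesis using that by blast
qed

section \<open>Finite Blaschke products and their model spaces\<close>

lemma prod_linear_expand:
  fixes a c :: "nat \<Rightarrow> complex"
  obtains q where "\<And>z. (\<Prod>i<n. a i + c i * z) = (\<Sum>k<n. q k * z ^ k) + (\<Prod>i<n. c i) * z ^ n"
proof -
  have "\<exists>q. \<forall>z. (\<Prod>i<n. a i + c i * z) = (\<Sum>k<n. q k * z ^ k) + (\<Prod>i<n. c i) * z ^ n"
  proof (induction n)
    case (Suc n)
    then obtain q where q: "\<And>z. (\<Prod>i<n. a i + c i * z) = (\<Sum>k<n. q k * z ^ k) + (\<Prod>i<n. c i) * z ^ n" by blast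
    define C where "C = (\<Prod>i<n. c i)"
    define q' where "q' k = a n * (if k < n then q k else C) + c n * (if k = 0 then 0 else q (k - 1))" for k
    have "(\<Prod>i<Suc n. a i + c i * z) = (\<Sum>k<Suc n. q' k * z ^ k) + (\<Prod>i<Suc n. c i) * z ^ Suc n" for z
    proof -
      have 1: "(\<Sum>k<Suc n. a n * (if k < n then q k else C) * z ^ k) = a n * ((\<Sum>k<n. q k * z ^ k) + C * z ^ n)"
        by (simp add: sum_distrib_left algebra_simps)
      have 2: "(\<Sum>k<Suc n. c n * (if k = 0 then 0 else q (k - 1)) * z ^ k) = c n * z * (\<Sum>k<n. q k * z ^ k)"
        by (subst sum.lessThan_Suc_shift) (simp add: sum_distrib_left algebra_simps)
      have "(\<Sum>k<Suc n. q' k * z ^ k) = a n * ((\<Sum>k<n. q k * z ^ k) + C * z ^ n) + c n * z * (\<Sum>k<n. q k * z ^ k)"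
        unfolding q'_def distrib_right sum.distrib 1 2 ..
      moreover have "(\<Prod>i<Suc n. a i + c i * z) = ((\<Sum>k<n. q k * z ^ k) + C * z ^ n) * (a n + c n * z)"
        by (simp add: q C_def)
      moreover have "(\<Prod>i<Suc n. c i) = C * c n" by (simp add: C_def)
      ultimately show ?thesis by (simp only:) (simp add: algebra_simps)
    qed
    then show ?case by blast
  qed simp
  then show ?thesis using that by blast
qed

text \<open>
  For one factor \<open>b\<close> with zero \<open>a\<close>, \<open>1 - \<bar>b z\<bar>\<^sup>2 = (1 - \<bar>a\<bar>\<^sup>2) (1 - \<bar>z\<bar>\<^sup>2) / \<bar>1 - cnj a \<cdot> z\<bar>\<^sup>2\<close>. For products use
  \<open>1 - x y \<le> (1 - x) + (1 - y)\<close> for \<open>x, y\<close> between 0 and 1.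
\<close>

lemma one_minus_prod_le:
  fixes \<alpha> :: "nat \<Rightarrow> complex"
  shows "\<forall>i<n. norm (\<alpha> i) < 1 \<Longrightarrow> \<exists>C\<ge>0. \<forall>z. norm z < 1 \<longrightarrow> 1 - (norm (\<Prod>i<n. (z - \<alpha> i) / (1 - cnj (\<alpha> i) * z)))\<^sup>2 \<le> C * (1 - norm z)"
proof (induction n)
  case 0
  show ?case by (intro exI[of _ 0]) simp
next
  case (Suc n)
  then obtain C where C: "0 \<le> C" "\<And>z. norm z < 1 \<Longrightarrow>
      1 - (norm (\<Prod>i<n. (z - \<alpha> i) / (1 - cnj (\<alpha> i) * z)))\<^sup>2 \<le> C * (1 - norm z)" by auto
  define a where "a = \<alpha> n"
  have a: "norm a < 1" using Suc.prems by (simp add: a_def)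
  define D where "D = 2 / (1 - norm a)\<^sup>2"
  have D: "0 \<le> D" by (simp add: D_def)
  have "1 - (norm (\<Prod>i<Suc n. (z - \<alpha> i) / (1 - cnj (\<alpha> i) * z)))\<^sup>2 \<le> (C + D) * (1 - norm z)" if z: "norm z < 1" for z
  proof -
    define x where "x = (norm (\<Prod>i<n. (z - \<alpha> i) / (1 - cnj (\<alpha> i) * z)))\<^sup>2"
    define y where "y = (norm ((z - a) / (1 - cnj a * z)))\<^sup>2"
    have y1: "y \<le> 1"
      using Moebius_function_norm_lt_1[OF a z, of 0] unfolding y_def Moebius_function_simple
      by (intro power_le_one) auto
    have "norm a * norm z \<le> norm a * 1" using z by (intro mult_left_mono) auto
    then have "1 - norm a \<le> norm (1 - cnj a * z)"
      using norm_triangle_ineq2[of 1 "cnj a * z"] by (simp add: norm_mult)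
    then have sq: "(1 - norm a)\<^sup>2 \<le> (norm (1 - cnj a * z))\<^sup>2" "0 < (1 - norm a)\<^sup>2"
      using a by (auto intro!: power_mono)
    have id: "(norm (1 - cnj a * z))\<^sup>2 - (norm (z - a))\<^sup>2 = (1 - (norm a)\<^sup>2) * (1 - (norm z)\<^sup>2)"
      unfolding cmod_power2 by (simp add: power2_eq_square algebra_simps)
    have "1 - y = ((norm (1 - cnj a * z))\<^sup>2 - (norm (z - a))\<^sup>2) / (norm (1 - cnj a * z))\<^sup>2"
    proof -
      have "0 < (norm (1 - cnj a * z))\<^sup>2" using sq by linarith
      moreover have "y = (norm (z - a))\<^sup>2 / (norm (1 - cnj a * z))\<^sup>2"
        by (simp only: y_def norm_divide power_divide)
      ultimately show ?thesis by (simp add: diff_divide_distrib del: power_eq_0_iff zero_less_power2)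
    qed
    also have "\<dots> \<le> (1 - (norm a)\<^sup>2) * (1 - (norm z)\<^sup>2) / (1 - norm a)\<^sup>2"
      unfolding id using sq a z by (intro divide_left_mono) (auto simp: power_le_one intro!: mult_pos_pos mult_nonneg_nonneg)
    also have "\<dots> \<le> 1 * (2 * (1 - norm z)) / (1 - norm a)\<^sup>2"
    proof (intro divide_right_mono mult_mono)
      have "1 - (norm z)\<^sup>2 = (1 + norm z) * (1 - norm z)" by (simp add: algebra_simps power2_eq_square)
      also have "\<dots> \<le> 2 * (1 - norm z)" using z by (intro mult_right_mono) auto
      finally show "1 - (norm z)\<^sup>2 \<le> 2 * (1 - norm z)" .
    qed (use a z in \<open>auto simp: power_le_one\<close>)
    also have "\<dots> = D * (1 - norm z)" by (simp add: D_def)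
    finally have y: "1 - y \<le> D * (1 - norm z)" .
    have x: "1 - x \<le> C * (1 - norm z)" using C(2)[OF z] by (simp add: x_def)
    have "y * (1 - x) \<le> C * (1 - norm z)"
    proof (cases "x \<le> 1")
      case True
      have "y * (1 - x) \<le> 1 * (1 - x)" using True y1 by (intro mult_right_mono) auto
      then show ?thesis using x by simp
    next
      case False
      have "y * (1 - x) \<le> 0" using False by (intro mult_nonneg_nonpos) (auto simp: y_def)
      also have "0 \<le> C * (1 - norm z)" using C z by auto
      finally show ?thesis .
    qed
    then have "1 - x * y \<le> (C + D) * (1 - norm z)" using y by (simp add: algebra_simps)
    then show ?thesis
      unfolding x_def y_def a_def prod.lessThan_Suc norm_mult power_mult_distrib .
  qed
  then show ?case using C(1) D by (intro exI[of _ "C + D"]) auto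
qed

lemma sum_fun_scale_apply: "(\<Sum>i\<in>A. fun_scale (c i) (f i)) z = (\<Sum>i\<in>A. c i * f i z)"
  by (induction A rule: infinite_finite_induct) (auto simp: fun_scale_def)

locale blaschke =
  fixes n :: nat and \<theta> :: real and \<alpha> :: "nat \<Rightarrow> complex" and B :: "complex \<Rightarrow> complex"
  assumes n: "1 \<le> n" and \<alpha>: "\<And>i. i < n \<Longrightarrow> norm (\<alpha> i) < 1"
    and B: "\<And>z. norm z < 1 \<Longrightarrow> B z = cis \<theta> * (\<Prod>i<n. (z - \<alpha> i) / (1 - cnj (\<alpha> i) * z))"
begin

definition numer :: "complex \<Rightarrow> complex" where "numer z = (\<Prod>i<n. z - \<alpha> i)"
definition denom :: "complex \<Rightarrow> complex" where "denom z = (\<Prod>i<n. 1 - cnj (\<alpha> i) * z)"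

lemma denom_nonzero: "norm z \<le> 1 \<Longrightarrow> denom z \<noteq> 0"
  using \<alpha> one_minus_cnj_mult_nonzero by (simp add: denom_def)

lemma B_eq: "norm z < 1 \<Longrightarrow> B z = cis \<theta> * (numer z / denom z)"
  by (simp add: B numer_def denom_def prod_dividef)

lemma holomorphic_numer: "numer holomorphic_on S" and holomorphic_denom: "denom holomorphic_on S"
  unfolding numer_def denom_def by (intro holomorphic_intros)+

lemma continuous_numer: "continuous_on S numer" and continuous_denom: "continuous_on S denom"
  using holomorphic_numer holomorphic_denom holomorphic_on_imp_continuous_on by blast+

lemma holomorphic_B: "B holomorphic_on ball 0 1"
  by (rule holomorphic_transform[of "\<lambda>z. cis \<theta> * (numer z / denom z)"])
     (auto intro!: holomorphic_intros holomorphic_numer holomorphic_denom simp: B_eq denom_nonzero)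

lemma norm_B_less:
  assumes z: "norm z < 1"
  shows "norm (B z) < 1"
proof -
  have b: "norm ((z - \<alpha> i) / (1 - cnj (\<alpha> i) * z)) < 1" if "i < n" for i
    using Moebius_function_norm_lt_1[OF \<alpha>[OF that] z, of 0] unfolding Moebius_function_simple .
  obtain m where m: "n = Suc m" using n by (cases n) auto
  have "(\<Prod>i<m. norm ((z - \<alpha> i) / (1 - cnj (\<alpha> i) * z))) \<le> 1"
    using b m by (intro prod_le_1) (auto intro: less_imp_le)
  then have "(\<Prod>i<m. norm ((z - \<alpha> i) / (1 - cnj (\<alpha> i) * z))) * norm ((z - \<alpha> m) / (1 - cnj (\<alpha> m) * z))
     \<le> 1 * norm ((z - \<alpha> m) / (1 - cnj (\<alpha> m) * z))" by (intro mult_right_mono) auto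
  also have "\<dots> < 1" using b[of m] m by simp
  finally show ?thesis using m unfolding B[OF z] norm_mult prod_norm[symmetric] by simp
qed

lemma B_ball: "B ` ball 0 1 \<subseteq> ball 0 1"
  using norm_B_less by auto

lemma one_minus_norm_B_le:
  obtains C where "0 \<le> C" "\<And>z. norm z < 1 \<Longrightarrow> 1 - (norm (B z))\<^sup>2 \<le> C * (1 - norm z)"
proof -
  obtain C where C: "C \<ge> 0" "\<forall>z. norm z < 1 \<longrightarrow> 1 - (norm (\<Prod>i<n. (z - \<alpha> i) / (1 - cnj (\<alpha> i) * z)))\<^sup>2 \<le> C * (1 - norm z)"
    using one_minus_prod_le[of n \<alpha>] \<alpha> by blast
  show ?thesis by (rule that[OF C(1)]) (use C(2) in \<open>simp add: B norm_mult\<close>)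
qed

text \<open>
  On the unit circle the numerator and the denominator are reflections of each other. In
  particular \<open>\<bar>B\<bar> = 1\<close> there.
\<close>

lemma circle_reflect:
  assumes "norm z = 1"
  shows "z ^ n * cnj (numer z) = denom z"
proof -
  have "z * cnj z = 1" using assms by (simp add: complex_norm_square[symmetric])
  then have "z * cnj (z - \<alpha> i) = 1 - cnj (\<alpha> i) * z" for i by (simp add: algebra_simps)
  moreover have "z ^ n * cnj (numer z) = (\<Prod>i<n. z * cnj (z - \<alpha> i))"
    unfolding prod.distrib numer_def by simp
  ultimately show ?thesis by (simp add: denom_def)
qed

definition model_monomial :: "nat \<Rightarrow> complex \<Rightarrow> complex" where
  "model_monomial i = (\<lambda>z. if norm z < 1 then z ^ i / denom z else 0)"

lemma model_monomial_bounded: obtains A where "\<And>z. norm (model_monomial i z) \<le> A"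
proof -
  have "continuous_on (cball 0 1) (\<lambda>z. z ^ i / denom z)"
    by (intro continuous_intros continuous_denom) (auto simp: denom_nonzero)
  then have "bounded ((\<lambda>z. z ^ i / denom z) ` cball 0 1)"
    by (intro compact_imp_bounded compact_continuous_image) auto
  then obtain A where A: "0 < A" "\<forall>y \<in> (\<lambda>z. z ^ i / denom z) ` cball 0 1. norm y \<le> A"
    unfolding bounded_pos by blast
  show ?thesis by (rule that[of A]) (use A in \<open>auto simp: model_monomial_def\<close>)
qed

lemma model_monomial_analytic: "model_monomial i \<in> disc_analytic"
  unfolding model_monomial_def
  by (intro disc_analyticI holomorphic_intros holomorphic_denom) (auto simp: denom_nonzero)

lemma model_monomial_hardy: "0 < p \<Longrightarrow> model_monomial i \<in> hardy_space p"
  using model_monomial_bounded[of i] hardy_norm_bounded(1)[OF _ model_monomial_analytic] by metis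

text \<open>
  On the unit circle \<open>z\<^sup>i / Q \<cdot> cnj B\<close> equals the conjugate of \<open>cis \<theta> \<cdot> z\<^sup>n\<^sup>-\<^sup>i / Q\<close>, whose product with any
  \<open>g\<close> is analytic and vanishes at 0, hence has mean 0 on circles. The inner product being a limit over radii
  \<open>r < 1\<close>, the difference \<open>E\<close> of the two functions is carried along; it tends to 0 uniformly on the circle of radius
  \<open>r\<close> while the means of \<open>\<bar>g\<bar>\<close> stay bounded.
\<close>

lemma model_monomial_in_model_space:
  assumes i: "i < n"
  shows "model_monomial i \<in> model_space B"
  unfolding model_space_def
proof (intro CollectI conjI ballI)
  show "model_monomial i \<in> hardy_space 2" by (rule model_monomial_hardy) simp
  fix g assume g: "g \<in> hardy_space 2"
  note gh = hardy_spaceD(2)[OF g]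
  define E where "E z = z ^ i / denom z * cnj (cis \<theta> * (numer z / denom z)) - cnj (cis \<theta> * (z ^ (n - i) / denom z))" for z
  have E1: "E z = 0" if z: "norm z = 1" for z
  proof -
    have zz: "z * cnj z = 1" using z by (simp add: complex_norm_square[symmetric])
    have z0: "z \<noteq> 0" using z by auto
    have "z ^ n * cnj z ^ (n - i) = z ^ i"
    proof -
      have "z ^ n = z ^ i * z ^ (n - i)" using i by (simp flip: power_add)
      then have "z ^ n * cnj z ^ (n - i) = z ^ i * (z * cnj z) ^ (n - i)"
        by (simp add: power_mult_distrib)
      then show ?thesis using zz by simp
    qed
    then have "z ^ n * (z ^ i * cnj (numer z)) = z ^ n * (cnj z ^ (n - i) * denom z)"
      using circle_reflect[OF z] by (metis mult.assoc mult.left_commute)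
    then have "z ^ i * cnj (numer z) = cnj z ^ (n - i) * denom z" using z0 by simp
    then have "z ^ i / denom z * cnj (numer z) = cnj z ^ (n - i)"
      using denom_nonzero[of z] z by (simp add: field_simps)
    then show ?thesis unfolding E_def by (simp add: divide_simps)
  qed
  have "continuous_on (cball 0 1) E"
    unfolding E_def by (intro continuous_intros continuous_denom continuous_numer) (auto simp: denom_nonzero)
  then have uc: "uniformly_continuous_on (cball 0 1) E"
    by (intro compact_uniformly_continuous) auto
  define I where "I r = integral {0..2*pi} (\<lambda>t. model_monomial i (of_real r * cis t) * cnj (mult_op B g (of_real r * cis t)) / of_real (2 * pi))" for r :: real
  define K where "K = 1 + hardy_norm 2 g powr 2"
  have K: "0 < K" unfolding K_def by (rule add_pos_nonneg) auto
  have bound: "norm (I r) \<le> \<epsilon> * K" if r: "0 \<le> r" "r < 1" and E\<epsilon>: "\<And>t. norm (E (of_real r * cis t)) \<le> \<epsilon>" for r \<epsilon>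
  proof -
    have nr: "norm (of_real r * cis t) < 1" for t using r by (simp add: norm_mult)
    define G where "G z = cis \<theta> * (z ^ (n - i) / denom z) * g z" for z
    have "G holomorphic_on ball 0 1"
      unfolding G_def by (intro holomorphic_intros holomorphic_denom gh) (auto simp: denom_nonzero)
    moreover have "G 0 = 0" using i by (simp add: G_def)
    ultimately have "((\<lambda>t. G (of_real r * cis t)) has_integral 0) {0..2*pi}"
      using mean_value_circle[of G r] r by simp
    from has_integral_cnj[THEN iffD2, OF this] have G0: "((\<lambda>t. cnj (G (of_real r * cis t))) has_integral 0) {0..2*pi}" by (simp add: o_def)
    let ?h = "\<lambda>t. E (of_real r * cis t) * cnj (g (of_real r * cis t))"
    have cg: "continuous_on {0..2*pi} (\<lambda>t. g (of_real r * cis t))" by (rule continuous_on_circle[OF gh r])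
    have cE: "continuous_on {0..2*pi} (\<lambda>t. E (of_real r * cis t))"
    proof (rule continuous_on_compose2[OF uniformly_continuous_imp_continuous[OF uc]])
      show "continuous_on {0..2*pi} (\<lambda>t. of_real r * cis t)" by (intro continuous_intros)
      show "(\<lambda>t. of_real r * cis t) ` {0..2*pi} \<subseteq> cball 0 1"
        using less_imp_le[OF nr] by auto
    qed
    have ih: "?h integrable_on {0..2*pi}"
      by (intro integrable_continuous_interval continuous_intros cE cg)
    have alg: "x * cnj (b * w) = (x * cnj b - cnj c) * cnj w + cnj (c * w)" for x b c w :: complex
      by (simp add: algebra_simps)
    have eq: "model_monomial i (of_real r * cis t) * cnj (mult_op B g (of_real r * cis t)) = ?h t + cnj (G (of_real r * cis t))" for t
      using nr[of t] unfolding model_monomial_def mult_op_def E_def G_def B_eq[OF nr] by (simp only: alg if_True)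
    have "I r = integral {0..2*pi} (\<lambda>t. ?h t + cnj (G (of_real r * cis t))) / of_real (2 * pi)"
      unfolding I_def eq by (rule integral_divide)
    also have "integral {0..2*pi} (\<lambda>t. ?h t + cnj (G (of_real r * cis t))) = integral {0..2*pi} ?h"
      using integral_unique[OF has_integral_add[OF integrable_integral[OF ih] G0]] by simp
    finally have Ir: "norm (I r) = norm (integral {0..2*pi} ?h) / (2 * pi)"
      by (simp add: norm_divide norm_mult)
    have \<epsilon>0: "0 \<le> \<epsilon>" using order_trans[OF norm_ge_zero E\<epsilon>] .
    have ig: "(\<lambda>t. norm (g (of_real r * cis t)) powr 2) integrable_on {0..2*pi}"
      by (rule circle_powr_integrable[OF gh r]) simp
    have I2: "((\<lambda>t. \<epsilon> * (1 + norm (g (of_real r * cis t)) powr 2)) has_integral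
       (\<epsilon> * (2 * pi + integral {0..2*pi} (\<lambda>t. norm (g (of_real r * cis t)) powr 2)))) {0..2*pi}"
      using has_integral_const_real[of "1::real" 0 "2 * pi"]
      by (intro has_integral_mult_right has_integral_add integrable_integral ig) simp
    have "norm (integral {0..2*pi} ?h) \<le> integral {0..2*pi} (\<lambda>t. \<epsilon> * (1 + norm (g (of_real r * cis t)) powr 2))"
    proof (rule integral_norm_bound_integral[OF ih])
      show "(\<lambda>t. \<epsilon> * (1 + norm (g (of_real r * cis t)) powr 2)) integrable_on {0..2*pi}" using I2 by blast
      fix t
      have "x \<le> 1 + x powr 2" if "0 \<le> x" for x :: real
        using that sum_squares_ge_zero[of "x - 1" 0] by (simp add: powr_numeral power2_eq_square algebra_simps)
      then show "norm (?h t) \<le> \<epsilon> * (1 + norm (g (of_real r * cis t)) powr 2)"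
        using E\<epsilon>[of t] \<epsilon>0 unfolding norm_mult complex_mod_cnj by (intro mult_mono) auto
    qed
    also have "\<dots> = \<epsilon> * (2 * pi * (1 + hardy_mean 2 g r))"
      unfolding integral_unique[OF I2] by (simp add: hardy_mean_eq algebra_simps)
    also have "\<dots> \<le> \<epsilon> * (2 * pi * K)"
      using hardy_mean_le_norm[OF g _ r] \<epsilon>0 by (intro mult_left_mono) (auto simp: K_def)
    finally show ?thesis by (simp add: Ir field_simps)
  qed
  have "(I \<longlongrightarrow> 0) (at_left 1)"
  proof (rule tendstoI)
    fix e :: real assume e: "0 < e"
    define \<epsilon> where "\<epsilon> = e / (2 * K)"
    have \<epsilon>: "0 < \<epsilon>" using e K by (simp add: \<epsilon>_def)
    obtain d where d: "0 < d" "\<And>x y. x \<in> cball 0 1 \<Longrightarrow> y \<in> cball 0 1 \<Longrightarrow> dist y x < d \<Longrightarrow> dist (E y) (E x) < \<epsilon>"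
      using uc \<epsilon> unfolding uniformly_continuous_on_def by metis
    have "dist (I r) 0 < e" if r: "max 0 (1 - d) < r" "r < 1" for r
    proof -
      have "norm (E (of_real r * cis t)) \<le> \<epsilon>" for t
      proof -
        have "of_real r * cis t - cis t = of_real (r - 1) * cis t" by (simp add: algebra_simps)
        then have "dist (of_real r * cis t) (cis t) < d" using r by (simp add: dist_norm norm_mult del: of_real_diff)
        then have "dist (E (of_real r * cis t)) (E (cis t)) < \<epsilon>"
          using r by (intro d(2)) (auto simp: norm_mult)
        then show ?thesis by (simp add: E1)
      qed
      then have "norm (I r) \<le> \<epsilon> * K" using r by (intro bound) auto
      also have "\<dots> < e" using e K by (simp add: \<epsilon>_def)
      finally show ?thesis by simp
    qed
    moreover have "max 0 (1 - d) < 1" using d by simp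
    ultimately show "\<forall>\<^sub>F r in at_left 1. dist (I r) 0 < e"
      unfolding eventually_at_left_field by blast
  qed
  then show "hardy_inner (model_monomial i) (mult_op B g) = 0"
    unfolding hardy_inner_def I_def by (intro tendsto_Lim) auto
qed

lemma inj_model_monomial: "inj model_monomial"
proof (rule injI)
  fix i j assume "model_monomial i = model_monomial j"
  then have "model_monomial i (1 / 2) = model_monomial j (1 / 2)" by simp
  then have "(1 / 2 :: complex) ^ i = (1 / 2) ^ j"
    using denom_nonzero[of "1 / 2"] by (simp add: model_monomial_def norm_divide)
  then have "(2 :: complex) ^ i = 2 ^ j" by (simp add: power_one_over)
  then have "norm ((2 :: complex) ^ i) = norm ((2 :: complex) ^ j)" by simp
  then show "i = j" by (simp add: norm_power)
qed

lemma model_monomial_independent: "cfun.independent (model_monomial ` {..<n})"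
proof (rule cfun.independent_if_scalars_zero)
  fix f and v assume 0: "(\<Sum>x\<in>model_monomial ` {..<n}. fun_scale (f x) x) = 0" and v: "v \<in> model_monomial ` {..<n}"
  define c where "c i = f (model_monomial i)" for i
  define R where "R = (\<Sum>i<n. monom (c i) i)"
  have s: "(\<Sum>i<n. fun_scale (c i) (model_monomial i)) = 0"
    using 0 by (subst (asm) sum.reindex) (auto simp: c_def o_def intro: inj_on_subset[OF inj_model_monomial])
  have "poly R z = 0" if z: "norm z < 1" for z
  proof -
    have "(\<Sum>i<n. c i * model_monomial i z) = 0" using s by (metis sum_fun_scale_apply zero_fun_apply)
    moreover have "(\<Sum>i<n. c i * model_monomial i z) = poly R z / denom z"
      using z by (simp add: R_def model_monomial_def poly_sum poly_monom sum_divide_distrib)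
    ultimately show ?thesis using denom_nonzero[of z] z by simp
  qed
  then have "ball 0 1 \<subseteq> {z. poly R z = 0}" by auto
  moreover have "infinite (ball (0::complex) 1)" by (intro uncountable_infinite uncountable_ball) simp
  ultimately have "R = 0" using poly_roots_finite finite_subset by blast
  then have "c i = 0" if "i < n" for i
    using that coeff_sum[of "\<lambda>i. monom (c i) i" "{..<n}" i] by (simp add: R_def[symmetric])
  then show "f v = 0" using v by (auto simp: c_def)
qed simp

text \<open>
  The \<open>n\<close> functions \<open>z\<^sup>i / Q\<close> are independent elements of a space that has a basis of \<open>n\<close> elements.
\<close>

lemma model_monomial_span:
  assumes u: "indexed_basis n u (model_space B)"
  shows "cfun.span (model_monomial ` {..<n}) = model_space B"
proof -
  have span: "cfun.span (u ` {..<n}) = model_space B" and inj: "inj_on u {..<n}"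
    using u by (auto simp: indexed_basis_def)
  have sub: "model_monomial ` {..<n} \<subseteq> cfun.span (u ` {..<n})"
    unfolding span using model_monomial_in_model_space by auto
  have "u ` {..<n} \<subseteq> cfun.span (model_monomial ` {..<n})"
  proof
    fix v assume v: "v \<in> u ` {..<n}"
    show "v \<in> cfun.span (model_monomial ` {..<n})"
    proof (rule ccontr)
      assume nv: "v \<notin> cfun.span (model_monomial ` {..<n})"
      then have "cfun.independent (insert v (model_monomial ` {..<n}))"
        by (intro cfun.independent_insertI model_monomial_independent)
      moreover have "insert v (model_monomial ` {..<n}) \<subseteq> cfun.span (u ` {..<n})"
        using sub v by (auto intro: cfun.span_base)
      ultimately have "card (insert v (model_monomial ` {..<n})) \<le> card (u ` {..<n})"
        using cfun.independent_span_bound[of "u ` {..<n}"] by simp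
      moreover have "v \<notin> model_monomial ` {..<n}" using nv by (auto intro: cfun.span_base)
      ultimately show False
        using card_image[OF inj] card_image[OF inj_on_subset[OF inj_model_monomial], of "{..<n}"] by simp
    qed
  qed
  then have "cfun.span (u ` {..<n}) \<subseteq> cfun.span (model_monomial ` {..<n})"
    by (intro cfun.span_minimal cfun.subspace_span)
  moreover have "cfun.span (model_monomial ` {..<n}) \<subseteq> cfun.span (u ` {..<n})"
    using sub by (intro cfun.span_minimal cfun.subspace_span)
  ultimately show ?thesis using span by auto
qed

lemma model_span_bounded:
  assumes v: "v \<in> cfun.span (model_monomial ` {..<n})"
  shows "v \<in> disc_analytic \<and> (\<exists>A. \<forall>z. norm (v z) \<le> A)"
  using v
proof (induction rule: cfun.span_induct_alt)
  case base
  then show ?case by (auto simp: disc_analytic_def zero_fun_def)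
next
  case (step c x y)
  then obtain i where x: "x = model_monomial i" by auto
  obtain A1 where A1: "\<And>z. norm (model_monomial i z) \<le> A1" using model_monomial_bounded by blast
  obtain A2 where A2: "\<And>z. norm (y z) \<le> A2" using step by blast
  have "norm ((fun_scale c x + y) z) \<le> norm c * A1 + A2" for z
  proof -
    have "norm ((fun_scale c x + y) z) \<le> norm (c * model_monomial i z) + norm (y z)"
      unfolding x fun_scale_def plus_fun_def by (rule norm_triangle_ineq)
    also have "\<dots> \<le> norm c * A1 + A2"
      using A1 A2 by (intro add_mono) (auto simp: norm_mult intro: mult_left_mono)
    finally show ?thesis .
  qed
  moreover have "fun_scale c x + y \<in> disc_analytic"
    using model_monomial_analytic[of i] step unfolding x disc_analytic_def fun_scale_def plus_fun_def
    by (auto intro!: holomorphic_intros)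
  ultimately show ?case by blast
qed

end

section \<open>Operators commuting with multiplication by a Blaschke product\<close>

lemma hardy_point_norm_bound:
  assumes p: "1 < p" and f: "f \<in> hardy_space p" and z: "norm z < 1"
  shows "norm (f z) \<le> ((1 + norm z) / (1 - norm z)) powr (1 / p) * hardy_norm p f"
proof -
  define K where "K = (1 + norm z) / (1 - norm z)"
  have K: "0 \<le> K" using z by (simp add: K_def)
  have "(norm (f z) powr p) powr (1 / p) \<le> (K * hardy_norm p f powr p) powr (1 / p)"
    using p unfolding K_def by (intro powr_mono2 hardy_point_bound f z) auto
  then have "norm (f z) \<le> K powr (1 / p) * hardy_norm p f"
    using p K by (simp add: powr_powr powr_mult hardy_norm_nonneg)
  then show ?thesis unfolding K_def .
qed

lemma hardy_space_add:
  assumes p: "0 < p" and f: "f \<in> hardy_space p" and g: "g \<in> hardy_space p"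
  shows "f + g \<in> hardy_space p"
proof (rule hardy_space_dominated[OF p _ f g, of _ 1])
  show "f + g \<in> disc_analytic"
    using hardy_spaceD[OF f] hardy_spaceD[OF g] unfolding disc_analytic_def plus_fun_def
    by (auto intro: holomorphic_on_add)
qed (auto simp: norm_triangle_ineq)

lemma hardy_space_scale: "0 < p \<Longrightarrow> f \<in> hardy_space p \<Longrightarrow> fun_scale c f \<in> hardy_space p"
  unfolding fun_scale_def by (rule hardy_mult_bounded(1)[where A = "norm c"]) auto

lemma bounded_hardy_operator_bound:
  assumes W: "bounded_hardy_operator p W"
  obtains C where "0 \<le> C" "\<And>f. f \<in> hardy_space p \<Longrightarrow> hardy_norm p (W f) \<le> C * hardy_norm p f"
proof -
  obtain C where C: "\<And>f. f \<in> hardy_space p \<Longrightarrow> hardy_norm p (W f) \<le> C * hardy_norm p f"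
    using W unfolding bounded_hardy_operator_def by blast
  have "hardy_norm p (W f) \<le> \<bar>C\<bar> * hardy_norm p f" if "f \<in> hardy_space p" for f
    by (rule order_trans[OF C[OF that] mult_right_mono[OF abs_ge_self hardy_norm_nonneg]])
  then show ?thesis using that[of "\<bar>C\<bar>"] by simp
qed

context blaschke
begin

lemma mult_B_hardy:
  assumes "0 < p" "f \<in> hardy_space p"
  shows "mult_op B f \<in> hardy_space p" "hardy_norm p (mult_op B f) \<le> hardy_norm p f"
  using hardy_mult_bounded[OF assms(1) holomorphic_B _ assms(2), of 1] norm_B_less
  by (auto simp: mult_op_def less_imp_le)

lemma compose_B_hardy:
  assumes p: "1 < p" and v: "v \<in> disc_analytic" "\<And>z. norm (v z) \<le> A" and h: "h \<in> hardy_space p"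
  shows "(\<lambda>z. v z * h (B z)) \<in> hardy_space p"
    "hardy_norm p (\<lambda>z. v z * h (B z)) \<le> A * ((1 + norm (B 0)) / (1 - norm (B 0))) powr (1 / p) * hardy_norm p h"
proof -
  have p0: "0 < p" using p by simp
  define K where "K = (1 + norm (B 0)) / (1 - norm (B 0))"
  have K: "0 \<le> K" using norm_B_less[of 0] by (simp add: K_def)
  define c where "c = (\<lambda>z. if norm z < 1 then h (B z) else 0)"
  have A: "0 \<le> A" using order_trans[OF norm_ge_zero v(2)] .
  have vD: "v holomorphic_on ball 0 1" "\<And>z. \<not> norm z < 1 \<Longrightarrow> v z = 0"
    using v(1) by (auto simp: disc_analytic_def)
  have "(h \<circ> B) holomorphic_on ball 0 1"
    using holomorphic_on_compose_gen[OF holomorphic_B hardy_spaceD(2)[OF h] B_ball] .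
  then have can: "c \<in> disc_analytic" unfolding c_def o_def by (rule disc_analyticI)
  have m: "hardy_mean p c r \<le> (K powr (1 / p) * hardy_norm p h) powr p" if r: "0 \<le> r" "r < 1" for r
  proof -
    have "hardy_mean p c r = hardy_mean p (h \<circ> B) r"
      using r by (intro hardy_mean_cong) (auto simp: c_def)
    also have "\<dots> \<le> K * hardy_norm p h powr p"
      unfolding K_def by (rule hardy_space_compose_norm[OF p h holomorphic_B B_ball r])
    also have "\<dots> = (K powr (1 / p) * hardy_norm p h) powr p"
      using p K by (simp add: powr_mult powr_powr hardy_norm_nonneg)
    finally show ?thesis .
  qed
  have ch: "c \<in> hardy_space p" using can m by (rule hardy_spaceI)
  have cn: "hardy_norm p c \<le> K powr (1 / p) * hardy_norm p h"
    using m p0 by (intro hardy_norm_le) (auto simp: hardy_norm_nonneg)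
  have e: "(\<lambda>z. v z * h (B z)) = (\<lambda>z. v z * c z)" using vD(2) by (auto simp: c_def)
  show "(\<lambda>z. v z * h (B z)) \<in> hardy_space p"
    unfolding e by (rule hardy_mult_bounded(1)[OF p0 vD(1) v(2) ch])
  have "hardy_norm p (\<lambda>z. v z * h (B z)) \<le> A * hardy_norm p c"
    unfolding e by (rule hardy_mult_bounded(2)[OF p0 vD(1) v(2) ch])
  also have "\<dots> \<le> A * (K powr (1 / p) * hardy_norm p h)" using A cn by (intro mult_left_mono)
  finally show "hardy_norm p (\<lambda>z. v z * h (B z)) \<le> A * ((1 + norm (B 0)) / (1 - norm (B 0))) powr (1 / p) * hardy_norm p h"
    by (simp add: K_def mult.assoc)
qed

text \<open>
  With \<open>w = B l\<close> and \<open>g = g w + (z - w) h\<close>, the function \<open>v \<cdot> (g \<circ> B)\<close> is \<open>g w \<cdot> v + (B - w) \<cdot> k\<close> for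
  \<open>k = v \<cdot> (h \<circ> B)\<close>. Its image is \<open>g w \<cdot> W v + (B - w) \<cdot> W k\<close>, and the second term vanishes at \<open>l\<close>.
\<close>

lemma commuting_formula:
  assumes p: "1 < p" and W: "bounded_hardy_operator p W"
    and comm: "\<And>f. f \<in> hardy_space p \<Longrightarrow> W (mult_op B f) = mult_op B (W f)"
    and v: "v \<in> disc_analytic" "\<And>z. norm (v z) \<le> A" and g: "g \<in> hardy_space p"
  shows "W (\<lambda>z. v z * g (B z)) = (\<lambda>z. W v z * g (B z))"
proof
  have p0: "0 < p" using p by simp
  have Wh: "\<And>f. f \<in> hardy_space p \<Longrightarrow> W f \<in> hardy_space p"
    and Wadd: "\<And>f g. f \<in> hardy_space p \<Longrightarrow> g \<in> hardy_space p \<Longrightarrow> W (f + g) = W f + W g"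
    and Wsc: "\<And>c f. f \<in> hardy_space p \<Longrightarrow> W (fun_scale c f) = fun_scale c (W f)"
    using W unfolding bounded_hardy_operator_def by auto
  have vh: "v \<in> hardy_space p" using hardy_norm_bounded(1)[OF p0 v] .
  fix l
  show "W (\<lambda>z. v z * g (B z)) l = W v l * g (B l)"
  proof (cases "norm l < 1")
    case False
    then show ?thesis using hardy_spaceD(3)[OF Wh[OF vh]] hardy_spaceD(3)[OF Wh[OF compose_B_hardy(1)[OF p v g]]] by simp
  next
    case True
    define w where "w = B l"
    have w: "norm w < 1" using norm_B_less[OF True] by (simp add: w_def)
    obtain h where h: "h \<in> hardy_space p" "\<And>z. norm z < 1 \<Longrightarrow> g z = g w + (z - w) * h z"
      using hardy_difference_quotient[OF p0 g w] by blast
    define k where "k = (\<lambda>z. v z * h (B z))"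
    have k: "k \<in> hardy_space p" unfolding k_def by (rule compose_B_hardy(1)[OF p v h(1)])
    have eq: "(\<lambda>z. v z * g (B z)) = fun_scale (g w) v + (mult_op B k + fun_scale (- w) k)"
    proof
      fix z
      show "v z * g (B z) = (fun_scale (g w) v + (mult_op B k + fun_scale (- w) k)) z"
      proof (cases "norm z < 1")
        case True
        show ?thesis
          unfolding fun_scale_def mult_op_def k_def plus_fun_def h(2)[OF norm_B_less[OF True]]
          by (simp add: algebra_simps)
      next
        case False
        then have "v z = 0" using hardy_spaceD(3)[OF vh] by simp
        then show ?thesis by (simp add: fun_scale_def mult_op_def k_def)
      qed
    qed
    have "W (\<lambda>z. v z * g (B z)) = fun_scale (g w) (W v) + (mult_op B (W k) + fun_scale (- w) (W k))"
      unfolding eq using vh k p0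
      by (simp only: Wadd Wsc comm mult_B_hardy hardy_space_add hardy_space_scale)
    then show ?thesis by (simp add: fun_scale_def mult_op_def w_def)
  qed
qed

text \<open>
  Evaluate \<open>W (v \<cdot> (g \<circ> B)) = W v \<cdot> (g \<circ> B)\<close> at \<open>l\<close> for the test function \<open>g\<close> at \<open>w = B l\<close>. With
  \<open>s = 1 - \<bar>w\<bar>\<^sup>2\<close>, the growth estimate gives
  \<open>\<bar>W v l\<bar>\<^sup>p / s\<^sup>2 \<le> const / (1 - \<bar>l\<bar>) \<cdot> 1 / s\<close>, and \<open>s \<le> D (1 - \<bar>l\<bar>)\<close>.
\<close>

lemma commuting_image_multiplier:
  assumes p: "1 < p" and W: "bounded_hardy_operator p W"
    and comm: "\<And>f. f \<in> hardy_space p \<Longrightarrow> W (mult_op B f) = mult_op B (W f)"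
    and v: "v \<in> disc_analytic" "\<And>z. norm (v z) \<le> A"
  shows "W v \<in> hardy_multipliers p"
proof -
  have p0: "0 < p" using p by simp
  have Wh: "\<And>f. f \<in> hardy_space p \<Longrightarrow> W f \<in> hardy_space p"
    using W unfolding bounded_hardy_operator_def by auto
  obtain C where C0: "0 \<le> C"
    and C: "\<And>f. f \<in> hardy_space p \<Longrightarrow> hardy_norm p (W f) \<le> C * hardy_norm p f"
    using bounded_hardy_operator_bound[OF W] by blast
  have vh: "v \<in> hardy_space p" using hardy_norm_bounded(1)[OF p0 v] .
  have A: "0 \<le> A" using order_trans[OF norm_ge_zero v(2)] .
  obtain D where D: "0 \<le> D" "\<And>z. norm z < 1 \<Longrightarrow> 1 - (norm (B z))\<^sup>2 \<le> D * (1 - norm z)"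
    using one_minus_norm_B_le by blast
  define K where "K = C * (A * ((1 + norm (B 0)) / (1 - norm (B 0))) powr (1 / p))"
  have K: "0 \<le> K" using A C0 by (simp add: K_def)
  define M where "M = (2 * K powr p * D) powr (1 / p)"
  have bound: "norm (W v l) \<le> M" if l: "norm l < 1" for l
  proof -
    define w where "w = B l"
    have w: "norm w < 1" using norm_B_less[OF l] by (simp add: w_def)
    define s where "s = 1 - (norm w)\<^sup>2"
    have s: "0 < s" using w by (simp add: s_def power_less_one_iff abs_square_less_1)
    obtain g where g: "g \<in> hardy_space p" "hardy_norm p g powr p \<le> 1 / s" "norm (g w) powr p = 1 / s\<^sup>2"
      using hardy_test_function[OF p w] unfolding s_def by blast
    let ?F = "\<lambda>z. v z * g (B z)"
    have F: "?F \<in> hardy_space p" by (rule compose_B_hardy(1)[OF p v g(1)])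
    have "hardy_norm p (W ?F) \<le> C * hardy_norm p ?F" by (rule C[OF F])
    also have "\<dots> \<le> C * (A * ((1 + norm (B 0)) / (1 - norm (B 0))) powr (1 / p) * hardy_norm p g)"
      by (intro mult_left_mono compose_B_hardy(2)[OF p v g(1)] C0)
    also have "\<dots> = K * hardy_norm p g" by (simp add: K_def)
    finally have "hardy_norm p (W ?F) powr p \<le> (K * hardy_norm p g) powr p"
      using p0 by (intro powr_mono2) (auto simp: hardy_norm_nonneg)
    also have "\<dots> = K powr p * hardy_norm p g powr p"
      using K by (simp add: powr_mult hardy_norm_nonneg)
    also have "\<dots> \<le> K powr p * (1 / s)" using g(2) by (intro mult_left_mono) auto
    finally have nW: "hardy_norm p (W ?F) powr p \<le> K powr p / s" by simp
    have "norm (W v l) powr p * (1 / s\<^sup>2) = norm (W ?F l) powr p"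
      using commuting_formula[OF p W comm v g(1)] g(3) by (simp add: w_def norm_mult powr_mult)
    also have "\<dots> \<le> (1 + norm l) / (1 - norm l) * hardy_norm p (W ?F) powr p"
      by (rule hardy_point_bound[OF p Wh[OF F] l])
    also have "\<dots> \<le> 2 / (1 - norm l) * (K powr p / s)"
      using l by (intro mult_mono nW divide_right_mono) auto
    finally have le: "norm (W v l) powr p * (1 / s\<^sup>2) \<le> 2 / (1 - norm l) * (K powr p / s)" .
    have "norm (W v l) powr p = norm (W v l) powr p * (1 / s\<^sup>2) * s\<^sup>2" using s by simp
    also have "\<dots> \<le> 2 / (1 - norm l) * (K powr p / s) * s\<^sup>2"
      using le by (rule mult_right_mono) simp
    also have "\<dots> = 2 * K powr p / (1 - norm l) * s"
      using s by (simp add: power2_eq_square)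
    also have "\<dots> \<le> 2 * K powr p / (1 - norm l) * (D * (1 - norm l))"
      using D(2)[OF l] l by (intro mult_left_mono) (auto simp: s_def w_def)
    also have "\<dots> = 2 * K powr p * D" using l by simp
    finally have "(norm (W v l) powr p) powr (1 / p) \<le> M"
      unfolding M_def using p0 by (intro powr_mono2) auto
    then show ?thesis using p0 by (simp add: powr_powr)
  qed
  note WvD = hardy_spaceD[OF Wh[OF vh]]
  show ?thesis
    unfolding hardy_multipliers_def using WvD(1) hardy_mult_bounded(1)[OF p0 WvD(2) bound] by blast
qed

text \<open>
  Write \<open>P = z\<^sup>n + \<Sum> a\<^sub>k z\<^sup>k\<close> and \<open>Q = c z\<^sup>n + \<Sum> b\<^sub>k z\<^sup>k\<close>. Subtracting the first from \<open>P / Q\<close> times the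
  second expresses \<open>z\<^sup>n\<close> through lower powers, with coefficients that are bounded functions of \<open>P / Q\<close>: the factor
  \<open>1 - c P / Q\<close> is invertible since \<open>\<bar>c\<bar> = \<Prod> \<bar>\<alpha>\<^sub>i\<bar> < 1\<close>.
\<close>

lemma top_power_elimination:
  obtains a b :: "nat \<Rightarrow> complex" and c where "norm c < 1"
    "\<And>z. (\<Sum>k<n. (b k * (numer z / denom z) - a k) * z ^ k) = z ^ n * (1 - c * (numer z / denom z)) \<or> denom z = 0"
    "\<And>z. denom z = (\<Sum>k<n. b k * z ^ k) + c * z ^ n"
proof -
  obtain a where a: "\<And>z. (\<Prod>i<n. - \<alpha> i + 1 * z) = (\<Sum>k<n. a k * z ^ k) + (\<Prod>i<n. 1) * z ^ n"
    using prod_linear_expand[where n = n and a = "\<lambda>i. - \<alpha> i" and c = "\<lambda>_. 1"] by blast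
  obtain b where b: "\<And>z. (\<Prod>i<n. 1 + - cnj (\<alpha> i) * z) = (\<Sum>k<n. b k * z ^ k) + (\<Prod>i<n. - cnj (\<alpha> i)) * z ^ n"
    using prod_linear_expand[where n = n and a = "\<lambda>i. 1" and c = "\<lambda>i. - cnj (\<alpha> i)"] by blast
  define c where "c = (\<Prod>i<n. - cnj (\<alpha> i))"
  have denom: "denom z = (\<Sum>k<n. b k * z ^ k) + c * z ^ n" for z using b[of z] by (simp add: denom_def c_def)
  have numer: "numer z = (\<Sum>k<n. a k * z ^ k) + z ^ n" for z using a[of z] by (simp add: numer_def)
  obtain m where m: "n = Suc m" using n by (cases n) auto
  have "norm c = (\<Prod>i<m. norm (\<alpha> i)) * norm (\<alpha> m)"
    by (simp add: c_def m prod_norm[symmetric] norm_mult)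
  also have "\<dots> \<le> 1 * norm (\<alpha> m)"
    using \<alpha> m by (intro mult_right_mono prod_le_1) (auto intro: less_imp_le)
  also have "\<dots> < 1" using \<alpha> m by simp
  finally have c: "norm c < 1" .
  have key: "(\<Sum>k<n. (b k * x - a k) * z ^ k) = z ^ n * (1 - c * x)" if "numer z = x * denom z" for z x
  proof -
    have "(\<Sum>k<n. (b k * x - a k) * z ^ k) = x * (\<Sum>k<n. b k * z ^ k) - (\<Sum>k<n. a k * z ^ k)"
      by (simp add: sum_distrib_left sum_subtractf algebra_simps)
    also have "\<dots> = x * (denom z - c * z ^ n) - (numer z - z ^ n)" using denom[of z] numer[of z] by simp
    finally show ?thesis using that by (simp add: algebra_simps)
  qed
  have "(\<Sum>k<n. (b k * (numer z / denom z) - a k) * z ^ k) = z ^ n * (1 - c * (numer z / denom z)) \<or> denom z = 0" for z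
  proof (cases "denom z = 0")
    case False
    then have "numer z = numer z / denom z * denom z" by simp
    from key[OF this] show ?thesis by blast
  qed blast
  then show ?thesis using c denom by (intro that[of c b a])
qed

text \<open>
  It suffices to have \<open>z\<^sup>i / Q \<cdot> (h \<circ> B)\<close> in \<open>S\<close> for all \<open>i\<close>, since \<open>z\<^sup>m\<close> is a combination of the functions
  \<open>z\<^sup>m\<^sup>+\<^sup>k / Q\<close> with \<open>k \<le> n\<close>. For \<open>i \<ge> n\<close> the elimination of \<open>z\<^sup>n\<close> replaces the exponent \<open>i\<close> by smaller ones,
  at the price of multiplying \<open>h\<close> by a bounded analytic function.
\<close>

lemma hardy_space_subset_module:
  assumes p: "1 < p"
    and add: "\<And>f g. f \<in> S \<Longrightarrow> g \<in> S \<Longrightarrow> f + g \<in> S" and scale: "\<And>c f. f \<in> S \<Longrightarrow> fun_scale c f \<in> S"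
    and zero: "(\<lambda>_. 0) \<in> S"
    and closed: "\<And>f. f \<in> hardy_space p \<Longrightarrow>
      (\<And>\<delta>. 0 < \<delta> \<Longrightarrow> \<exists>g\<in>S. hardy_norm p (\<lambda>z. f z - g z) \<le> \<delta>) \<Longrightarrow> f \<in> S"
    and mod: "\<And>i h. i < n \<Longrightarrow> h \<in> hardy_space p \<Longrightarrow> (\<lambda>z. model_monomial i z * h (B z)) \<in> S"
  shows "hardy_space p \<subseteq> S"
proof (rule hardy_space_subset_closed[OF p closed])
  have p0: "0 < p" using p by simp
  have sumS: "(\<lambda>z. \<Sum>k<m. f k z) \<in> S" if "\<And>k. k < m \<Longrightarrow> f k \<in> S" for f :: "nat \<Rightarrow> complex \<Rightarrow> complex" and m :: nat
    using that
  proof (induction m)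
    case (Suc m)
    then have "(\<lambda>z. \<Sum>k<m. f k z) + f m \<in> S" by (intro add) auto
    then show ?case by (simp add: plus_fun_def)
  qed (simp add: zero)
  obtain a b c where c: "norm c < 1"
    and rec: "\<And>z. (\<Sum>k<n. (b k * (numer z / denom z) - a k) * z ^ k) = z ^ n * (1 - c * (numer z / denom z)) \<or> denom z = 0"
    and denom: "\<And>z. denom z = (\<Sum>k<n. b k * z ^ k) + c * z ^ n"
    by (rule top_power_elimination) (rule that)
  have monomialS: "\<forall>h \<in> hardy_space p. (\<lambda>z. model_monomial i z * h (B z)) \<in> S" for i
  proof (induction i rule: less_induct)
    case (less i)
    show ?case
    proof (cases "i < n")
      case True
      then show ?thesis using mod by blast
    next
      case False
      show ?thesis
      proof
        fix h assume h: "h \<in> hardy_space p"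
        \<comment> \<open>Division by \<open>cis \<theta>\<close> turns the value of \<open>B\<close> into that of \<open>numer / denom\<close>.\<close>
        define t where "t w = w / cis \<theta>" for w
        have nt: "norm (c * t w) \<le> norm c" if "norm w < 1" for w
          using that by (simp add: t_def norm_mult norm_divide mult_left_le)
        have ne: "1 - c * t w \<noteq> 0" if "norm w < 1" for w
          using nt[OF that] c by (metis norm_one not_le right_minus_eq)
        define m where "m k w = (b k * t w - a k) / (1 - c * t w)" for k w
        have hk: "(\<lambda>w. m k w * h w) \<in> hardy_space p" for k
        proof (rule hardy_mult_bounded(1)[OF p0 _ _ h])
          show "m k holomorphic_on ball 0 1"
            unfolding m_def t_def using ne by (intro holomorphic_intros) (auto simp: t_def)
          fix w :: complex assume w: "norm w < 1"
          have "norm (b k * t w) \<le> norm (b k)" using w by (simp add: t_def norm_mult norm_divide mult_left_le)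
          then have "norm (b k * t w - a k) \<le> norm (b k) + norm (a k)"
            using norm_triangle_ineq4[of "b k * t w" "a k"] by linarith
          moreover have "1 - norm c \<le> norm (1 - c * t w)"
            using norm_triangle_ineq2[of 1 "c * t w"] nt[OF w] by simp
          ultimately show "norm (m k w) \<le> (norm (b k) + norm (a k)) / (1 - norm c)"
            using c unfolding m_def norm_divide by (intro frac_le) auto
        qed
        have "(\<lambda>z. \<Sum>k<n. model_monomial (i - n + k) z * (m k (B z) * h (B z))) \<in> S"
        proof (rule sumS)
          fix k assume "k < n"
          then have "i - n + k < i" using False by simp
          from bspec[OF less.IH[OF this] hk[of k]]
          show "(\<lambda>z. model_monomial (i - n + k) z * (m k (B z) * h (B z))) \<in> S" .
        qed
        moreover have "(\<lambda>z. \<Sum>k<n. model_monomial (i - n + k) z * (m k (B z) * h (B z))) = (\<lambda>z. model_monomial i z * h (B z))"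
        proof
          fix z
          show "(\<Sum>k<n. model_monomial (i - n + k) z * (m k (B z) * h (B z))) = model_monomial i z * h (B z)"
          proof (cases "norm z < 1")
            case True
            have tB: "t (B z) = numer z / denom z" using True by (simp add: t_def B_eq)
            have ne': "1 - c * t (B z) \<noteq> 0" by (rule ne[OF norm_B_less[OF True]])
            have "(\<Sum>k<n. model_monomial (i - n + k) z * (m k (B z) * h (B z)))
               = (\<Sum>k<n. (b k * t (B z) - a k) * z ^ k) * (z ^ (i - n) / denom z / (1 - c * t (B z)) * h (B z))"
              using True unfolding sum_distrib_right
              by (intro sum.cong refl) (simp add: model_monomial_def m_def power_add)
            also have "\<dots> = z ^ n * (1 - c * t (B z)) * (z ^ (i - n) / denom z / (1 - c * t (B z)) * h (B z))"
              using rec[of z] denom_nonzero[of z] True unfolding tB by simp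
            also have "\<dots> = z ^ (n + (i - n)) / denom z * h (B z)"
              using ne' unfolding power_add by simp
            also have "\<dots> = model_monomial i z * h (B z)" using False True by (simp add: model_monomial_def)
            finally show ?thesis .
          qed (simp add: model_monomial_def)
        qed
        ultimately show "(\<lambda>z. model_monomial i z * h (B z)) \<in> S" by simp
      qed
    qed
  qed
  have "model_monomial i \<in> S" for i
  proof -
    have "(\<lambda>z. model_monomial i z * disc_one (B z)) = model_monomial i"
      using norm_B_less by (auto simp: model_monomial_def disc_one_def)
    then show ?thesis using bspec[OF monomialS disc_one(1)[OF p0], of i] by simp
  qed
  then have mono: "(\<lambda>z. if norm z < 1 then z ^ m else 0) \<in> S" for m
  proof -
    have "(\<lambda>z. \<Sum>k<n. fun_scale (b k) (model_monomial (m + k)) z) + fun_scale c (model_monomial (m + n)) \<in> S"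
      using \<open>\<And>i. model_monomial i \<in> S\<close> by (intro add sumS scale)
    moreover have "(\<lambda>z. \<Sum>k<n. fun_scale (b k) (model_monomial (m + k)) z) + fun_scale c (model_monomial (m + n))
      = (\<lambda>z. if norm z < 1 then z ^ m else 0)"
    proof
      fix z
      show "((\<lambda>z. \<Sum>k<n. fun_scale (b k) (model_monomial (m + k)) z) + fun_scale c (model_monomial (m + n))) z
        = (if norm z < 1 then z ^ m else 0)"
      proof (cases "norm z < 1")
        case True
        have "(\<Sum>k<n. b k * (z ^ (m + k) / denom z)) + c * (z ^ (m + n) / denom z)
            = z ^ m / denom z * ((\<Sum>k<n. b k * z ^ k) + c * z ^ n)"
          by (simp add: power_add sum_distrib_left algebra_simps)
        also have "\<dots> = z ^ m" unfolding denom[symmetric] using denom_nonzero[of z] True by simp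
        finally show ?thesis using True by (simp add: fun_scale_def model_monomial_def)
      qed (simp add: fun_scale_def model_monomial_def)
    qed
    ultimately show ?thesis by simp
  qed
  fix N and q :: "nat \<Rightarrow> complex"
  have "(\<lambda>z. \<Sum>k<N. fun_scale (q k) (\<lambda>z. if norm z < 1 then z ^ k else 0) z) \<in> S"
    by (intro sumS scale mono)
  moreover have "(\<lambda>z. \<Sum>k<N. fun_scale (q k) (\<lambda>z. if norm z < 1 then z ^ k else 0) z)
    = (\<lambda>z. if norm z < 1 then \<Sum>k<N. q k * z ^ k else 0)"
    by (auto simp: fun_scale_def)
  ultimately show "(\<lambda>z. if norm z < 1 then \<Sum>k<N. q k * z ^ k else 0) \<in> S" by simp
qed

text \<open>
  The difference of the two sides depends linearly and boundedly on \<open>f\<close> and vanishes at the approximants, and norm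
  bounds give pointwise bounds.
\<close>

lemma commute_set_closed:
  assumes p: "1 < p" and W: "bounded_hardy_operator p W"
    and f: "f \<in> hardy_space p"
    and approx: "\<And>\<delta>. 0 < \<delta> \<Longrightarrow> \<exists>g\<in>hardy_space p. W (mult_op B g) = mult_op B (W g) \<and> hardy_norm p (\<lambda>z. f z - g z) \<le> \<delta>"
  shows "W (mult_op B f) = mult_op B (W f)"
proof
  have p0: "0 < p" using p by simp
  have Wh: "\<And>f. f \<in> hardy_space p \<Longrightarrow> W f \<in> hardy_space p"
    and Wadd: "\<And>f g. f \<in> hardy_space p \<Longrightarrow> g \<in> hardy_space p \<Longrightarrow> W (f + g) = W f + W g"
    using W unfolding bounded_hardy_operator_def by auto
  obtain C where C0: "0 \<le> C"
    and C: "\<And>f. f \<in> hardy_space p \<Longrightarrow> hardy_norm p (W f) \<le> C * hardy_norm p f"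
    using bounded_hardy_operator_bound[OF W] by blast
  fix z
  show "W (mult_op B f) z = mult_op B (W f) z"
  proof (cases "norm z < 1")
    case False
    then show ?thesis
      using hardy_spaceD(3)[OF Wh[OF f]] hardy_spaceD(3)[OF Wh[OF mult_B_hardy(1)[OF p0 f]]] by (simp add: mult_op_def)
  next
    case True
    define K where "K = ((1 + norm z) / (1 - norm z)) powr (1 / p)"
    have K: "0 \<le> K" by (simp add: K_def)
    have le: "norm (W (mult_op B f) z - mult_op B (W f) z) \<le> 2 * (K * C) * \<delta>" if "0 < \<delta>" for \<delta>
    proof -
      obtain g where g: "g \<in> hardy_space p" "W (mult_op B g) = mult_op B (W g)" "hardy_norm p (\<lambda>z. f z - g z) \<le> \<delta>"
        using approx[OF \<open>0 < \<delta>\<close>] by blast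
      define d where "d = (\<lambda>z. f z - g z)"
      have "f + fun_scale (-1) g = d" by (auto simp: d_def fun_scale_def)
      then have d: "d \<in> hardy_space p"
        using hardy_space_add[OF p0 f hardy_space_scale[OF p0 g(1), of "-1"]] by simp
      have f1: "f = g + d" by (auto simp: d_def)
      have f2: "mult_op B f = mult_op B g + mult_op B d" by (auto simp: d_def mult_op_def algebra_simps)
      have eq: "W (mult_op B f) z - mult_op B (W f) z = W (mult_op B d) z - B z * W d z"
      proof -
        have "W (mult_op B f) = W (mult_op B g) + W (mult_op B d)"
          unfolding f2 by (intro Wadd mult_B_hardy p0 g d)
        moreover have "W f = W g + W d" unfolding f1 by (intro Wadd g d)
        ultimately show ?thesis by (simp add: g(2)) (simp add: mult_op_def algebra_simps)
      qed
      have Bd: "norm (B z * W d z) \<le> norm (W d z)"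
        using norm_B_less[OF True] by (simp add: norm_mult mult_left_le_one_le)
      have 1: "norm (W (mult_op B d) z) \<le> K * (C * \<delta>)"
      proof -
        have "norm (W (mult_op B d) z) \<le> K * hardy_norm p (W (mult_op B d))"
          unfolding K_def by (intro hardy_point_norm_bound p True Wh mult_B_hardy p0 d)
        also have "\<dots> \<le> K * (C * \<delta>)"
        proof (intro mult_left_mono K)
          have "hardy_norm p (W (mult_op B d)) \<le> C * hardy_norm p (mult_op B d)" by (intro C mult_B_hardy p0 d)
          also have "\<dots> \<le> C * \<delta>"
            using mult_B_hardy(2)[OF p0 d] g(3) by (intro mult_left_mono) (auto simp: d_def C0)
          finally show "hardy_norm p (W (mult_op B d)) \<le> C * \<delta>" .
        qed
        finally show ?thesis .
      qed
      have 2: "norm (W d z) \<le> K * (C * \<delta>)"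
      proof -
        have "norm (W d z) \<le> K * hardy_norm p (W d)"
          unfolding K_def by (intro hardy_point_norm_bound p True Wh d)
        also have "\<dots> \<le> K * (C * \<delta>)"
        proof (intro mult_left_mono K)
          have "hardy_norm p (W d) \<le> C * hardy_norm p d" by (intro C d)
          also have "\<dots> \<le> C * \<delta>" using g(3) by (intro mult_left_mono) (auto simp: d_def C0)
          finally show "hardy_norm p (W d) \<le> C * \<delta>" .
        qed
        finally show ?thesis .
      qed
      show ?thesis
        using norm_triangle_ineq4[of "W (mult_op B d) z" "B z * W d z"] Bd 1 2 unfolding eq by simp
    qed
    have "norm (W (mult_op B f) z - mult_op B (W f) z) \<le> 0"
    proof (rule field_le_epsilon)
      fix e :: real assume e: "0 < e"
      have KC: "0 \<le> K * C" using K C0 by simp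
      have "2 * (K * C) * (e / (2 * (K * C) + 1)) \<le> e"
        using KC e by (simp add: divide_simps)
      moreover have "0 < e / (2 * (K * C) + 1)" using KC e by (intro divide_pos_pos) auto
      ultimately show "norm (W (mult_op B f) z - mult_op B (W f) z) \<le> 0 + e"
        using le[of "e / (2 * (K * C) + 1)"] by linarith
    qed
    then show ?thesis by simp
  qed
qed

end

theorem mainTheorem2:
  fixes p :: real and n :: nat and B :: "complex \<Rightarrow> complex"
    and u :: "nat \<Rightarrow> complex \<Rightarrow> complex"
    and W :: "(complex \<Rightarrow> complex) \<Rightarrow> (complex \<Rightarrow> complex)"
  assumes "1 < p"
    and "n \<ge> 1"
    and "finite_blaschke n B"
    and "indexed_basis n u (model_space B)"
    and "bounded_hardy_operator p W"
  shows "(\<forall>f \<in> hardy_space p. W (mult_op B f) = mult_op B (W f)) \<longleftrightarrow>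
    (\<exists>\<phi> :: nat \<Rightarrow> complex \<Rightarrow> complex. (\<forall>k<n. \<phi> k \<in> hardy_multipliers p) \<and>
      (\<forall>f :: nat \<Rightarrow> complex \<Rightarrow> complex. (\<forall>j<n. f j \<in> hardy_space p) \<longrightarrow>
        W (\<lambda>z. \<Sum>j<n. u j z * (f j \<circ> B) z) = (\<lambda>z. \<Sum>k<n. \<phi> k z * (f k \<circ> B) z)))"
    (is "?L \<longleftrightarrow> ?R")
proof -
  note p = \<open>1 < p\<close> and W = \<open>bounded_hardy_operator p W\<close>
  have p0: "0 < p" using p by simp
  obtain \<theta> \<alpha> where "\<forall>i<n. \<alpha> i \<in> ball 0 1"
    "\<forall>z \<in> ball 0 1. B z = cis \<theta> * (\<Prod>i<n. (z - \<alpha> i) / (1 - cnj (\<alpha> i) * z))"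
    using assms(3) unfolding finite_blaschke_def by blast
  then interpret blaschke n \<theta> \<alpha> B using assms(2) by unfold_locales auto
  have Wh: "\<And>f. f \<in> hardy_space p \<Longrightarrow> W f \<in> hardy_space p"
    and Wadd: "\<And>f g. f \<in> hardy_space p \<Longrightarrow> g \<in> hardy_space p \<Longrightarrow> W (f + g) = W f + W g"
    and Wsc: "\<And>c f. f \<in> hardy_space p \<Longrightarrow> W (fun_scale c f) = fun_scale c (W f)"
    using W unfolding bounded_hardy_operator_def by auto
  have zero: "(\<lambda>_. 0) \<in> hardy_space p"
    by (rule hardy_norm_bounded(1)[OF p0, of _ 0]) (auto simp: disc_analytic_def)
  have W0: "W (\<lambda>_. 0) = (\<lambda>_. 0)"
    using Wsc[OF zero, of 0] by (simp add: fun_scale_def)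
  have span: "cfun.span (model_monomial ` {..<n}) = cfun.span (u ` {..<n})"
    using model_monomial_span[OF assms(4)] assms(4) by (simp add: indexed_basis_def)
  have u: "u j \<in> disc_analytic" "\<exists>A. \<forall>z. norm (u j z) \<le> A" if "j < n" for j
    using model_span_bounded[of "u j"] that unfolding span by (auto intro: cfun.span_base)
  have uh: "(\<lambda>z. u j z * g (B z)) \<in> hardy_space p" if "j < n" "g \<in> hardy_space p" for j g
    using u[OF that(1)] compose_B_hardy(1)[OF p _ _ that(2)] by blast
  show ?thesis
  proof
    assume L: ?L
    then have comm: "\<And>f. f \<in> hardy_space p \<Longrightarrow> W (mult_op B f) = mult_op B (W f)" by blast
    have form: "W (\<lambda>z. u j z * g (B z)) = (\<lambda>z. W (u j) z * g (B z))" if "j < n" "g \<in> hardy_space p" for j g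
      using u[OF that(1)] commuting_formula[OF p W comm _ _ that(2)] by blast
    have "W (\<lambda>z. \<Sum>j<m. u j z * f j (B z)) = (\<lambda>z. \<Sum>k<m. W (u k) z * f k (B z)) \<and>
        (\<lambda>z. \<Sum>j<m. u j z * f j (B z)) \<in> hardy_space p"
      if f: "\<forall>j<n. f j \<in> hardy_space p" and m: "m \<le> n" for f :: "nat \<Rightarrow> complex \<Rightarrow> complex" and m
      using m
    proof (induction m)
      case 0
      then show ?case using W0 zero by simp
    next
      case (Suc m)
      have eq: "(\<lambda>z. \<Sum>j<Suc m. u j z * f j (B z)) = (\<lambda>z. \<Sum>j<m. u j z * f j (B z)) + (\<lambda>z. u m z * f m (B z))"
        by (simp add: plus_fun_def)
      have m: "m < n" "f m \<in> hardy_space p" using Suc.prems f by auto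
      show ?case
        unfolding eq using Suc Wadd[OF _ uh[OF m]] hardy_space_add[OF p0 _ uh[OF m]]
        by (simp add: form[OF m] plus_fun_def)
    qed
    moreover have "W (u k) \<in> hardy_multipliers p" if "k < n" for k
      using u[OF that] commuting_image_multiplier[OF p W comm] by blast
    ultimately show ?R by (intro exI[of _ "\<lambda>k. W (u k)"]) auto
  next
    assume ?R
    then obtain \<phi> where \<phi>: "\<And>f. \<forall>j<n. f j \<in> hardy_space p \<Longrightarrow>
        W (\<lambda>z. \<Sum>j<n. u j z * (f j \<circ> B) z) = (\<lambda>z. \<Sum>k<n. \<phi> k z * (f k \<circ> B) z)" by blast
    \<comment> \<open>Only one of the functions \<open>f k\<close> is nonzero.\<close>
    have W\<phi>: "W (\<lambda>z. u j z * g (B z)) = (\<lambda>z. \<phi> j z * g (B z))" if j: "j < n" and g: "g \<in> hardy_space p" for j g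
    proof -
      have "W (\<lambda>z. \<Sum>k<n. u k z * ((if k = j then g else (\<lambda>_. 0)) \<circ> B) z) =
          (\<lambda>z. \<Sum>k<n. \<phi> k z * ((if k = j then g else (\<lambda>_. 0)) \<circ> B) z)"
        using g zero by (intro \<phi>) auto
      moreover have "(\<Sum>k<n. c k * ((if k = j then g else (\<lambda>_. 0)) \<circ> B) z) = c j * g (B z)" for c :: "nat \<Rightarrow> complex" and z
      proof -
        have "(\<Sum>k<n. c k * ((if k = j then g else (\<lambda>_. 0)) \<circ> B) z) = (\<Sum>k<n. if k = j then c k * g (B z) else 0)"
          by (intro sum.cong) auto
        then show ?thesis using j by simp
      qed
      ultimately show ?thesis by simp
    qed
    define S where "S = {f \<in> hardy_space p. W (mult_op B f) = mult_op B (W f)}"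
    have addS: "f + g \<in> S" if "f \<in> S" "g \<in> S" for f g
    proof -
      have "mult_op B (f + g) = mult_op B f + mult_op B g" by (auto simp: mult_op_def algebra_simps)
      moreover have "f \<in> hardy_space p" "g \<in> hardy_space p"
        "W (mult_op B f) = mult_op B (W f)" "W (mult_op B g) = mult_op B (W g)"
        using that by (auto simp: S_def)
      ultimately have "W (mult_op B (f + g)) = mult_op B (W f) + mult_op B (W g)" "W (f + g) = W f + W g"
        using p0 by (simp_all only: Wadd mult_B_hardy)
      moreover have "mult_op B (W f) + mult_op B (W g) = mult_op B (W f + W g)"
        by (auto simp: mult_op_def algebra_simps)
      ultimately show ?thesis using that p0 by (simp add: S_def hardy_space_add)
    qed
    have scaleS: "fun_scale c f \<in> S" if "f \<in> S" for c f
    proof -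
      have "mult_op B (fun_scale c f) = fun_scale c (mult_op B f)" by (auto simp: mult_op_def fun_scale_def)
      moreover have "f \<in> hardy_space p" "W (mult_op B f) = mult_op B (W f)"
        using that by (auto simp: S_def)
      ultimately have "W (mult_op B (fun_scale c f)) = fun_scale c (mult_op B (W f))"
          "W (fun_scale c f) = fun_scale c (W f)"
        using p0 by (simp_all only: Wsc mult_B_hardy)
      moreover have "fun_scale c (mult_op B (W f)) = mult_op B (fun_scale c (W f))"
        by (auto simp: mult_op_def fun_scale_def)
      ultimately show ?thesis using that p0 by (simp add: S_def hardy_space_scale)
    qed
    have zeroS: "(\<lambda>_. 0) \<in> S" using zero W0 by (simp add: S_def mult_op_def)
    have uS: "(\<lambda>z. u j z * h (B z)) \<in> S" if j: "j < n" and h: "h \<in> hardy_space p" for j h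
    proof -
      have zh: "(\<lambda>w. w * h w) \<in> hardy_space p"
        by (rule hardy_mult_bounded(1)[OF p0 _ _ h, of _ 1]) (auto intro: holomorphic_intros)
      have "mult_op B (\<lambda>z. u j z * h (B z)) = (\<lambda>z. u j z * (B z * h (B z)))"
        by (auto simp: mult_op_def)
      then have "W (mult_op B (\<lambda>z. u j z * h (B z))) = (\<lambda>z. \<phi> j z * (B z * h (B z)))"
        using W\<phi>[OF j zh] by simp
      also have "\<dots> = mult_op B (W (\<lambda>z. u j z * h (B z)))"
        unfolding W\<phi>[OF j h] by (auto simp: mult_op_def)
      finally show ?thesis using uh[OF j h] by (simp add: S_def)
    qed
    have spanS: "(\<lambda>z. v z * h (B z)) \<in> S" if "v \<in> cfun.span (u ` {..<n})" and h: "h \<in> hardy_space p" for v h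
      using that(1)
    proof (induction rule: cfun.span_induct_alt)
      case base
      then show ?case using zeroS by simp
    next
      case (step c x y)
      then obtain j where j: "j < n" "x = u j" by auto
      have "fun_scale c (\<lambda>z. u j z * h (B z)) + (\<lambda>z. y z * h (B z)) \<in> S"
        using step by (intro addS scaleS uS j h)
      moreover have "fun_scale c (\<lambda>z. u j z * h (B z)) + (\<lambda>z. y z * h (B z)) = (\<lambda>z. (fun_scale c x + y) z * h (B z))"
        by (auto simp: j(2) fun_scale_def algebra_simps)
      ultimately show ?case by simp
    qed
    have "hardy_space p \<subseteq> S"
    proof (rule hardy_space_subset_module[OF p addS scaleS zeroS])
      fix f assume f: "f \<in> hardy_space p"
        and approx: "\<And>\<delta>. 0 < \<delta> \<Longrightarrow> \<exists>g\<in>S. hardy_norm p (\<lambda>z. f z - g z) \<le> \<delta>"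
      have "W (mult_op B f) = mult_op B (W f)"
      proof (rule commute_set_closed[OF p W f])
        fix \<delta> :: real assume "0 < \<delta>"
        from approx[OF this] obtain g where "g \<in> S" "hardy_norm p (\<lambda>z. f z - g z) \<le> \<delta>" by blast
        then show "\<exists>g\<in>hardy_space p. W (mult_op B g) = mult_op B (W g) \<and> hardy_norm p (\<lambda>z. f z - g z) \<le> \<delta>"
          unfolding S_def by blast
      qed
      then show "f \<in> S" using f by (simp add: S_def)
    next
      fix i h assume "i < n" "h \<in> hardy_space p"
      then show "(\<lambda>z. model_monomial i z * h (B z)) \<in> S"
        by (intro spanS) (auto simp flip: span intro: cfun.span_base)
    qed
    then show ?L by (auto simp: S_def)
  qed
qed

end
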